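(* Let $(G,E)$ be a self-similar groupoid action. If one of the six groupoids $\widetilde{\mathcal G}(G,E)$, $\widetilde{\mathcal G}_0(G,E)$, $\widetilde{\mathcal G}_{00}(G,E)$, $\mathcal G(G,E)$, $\mathcal G_0(G,E)$, $\mathcal G_{00}(G,E)$ is Hausdorff, then all of them are. This happens if and only if $(G,E)$ satisfies (Fin), that is, if for every $g\in G$ there are finitely many minimal strongly $g$-fixed paths.
   Context: A directed graph $E=(E^0,E^1,r,s)$ has vertices $E^0$, edges $E^1$, and maps $r,s:E^1\to E^0$. For $n\ge1$, $E^n$ is the set of paths $\mu=\mu_1\cdots\mu_n$ ($\mu_i\in E^1$, $s(\mu_i)=r(\mu_{i+1})$), $r(\mu)=r(\mu_1)$, $s(\mu)=s(\mu_n)$, $|\mu|=n$; vertices are paths of length $0$ with $r(v)=s(v)=v$; $E^*=\bigcup_{n\ge0}E^n$; $E^\infty$ is the set of infinite paths; $vE^n,vE^*$ denote paths with range $v$. $\beta$ is a prefix of $\alpha$ if $\alpha=\beta\beta'$. A vertex $v$ is singular if $vE^1$ is empty or infinite. $(G,E)$ is a self-similar action if $G$ is a discrete groupoid with $G^0=E^0$, equipped with a left action $(g,e)\mapsto ge$ on $E^1$ (defined when $s(g)=r(e)$, with $r(ge)=r(g)$, $(hg)e=h(ge)$, $r(e)e=e$) and a map $(g,e)\mapsto g|_e\in G$ with $(hg)|_e=h|_{ge}\,g|_e$, $s(g|_e)=s(e)$, $r(g|_e)=s(ge)$. It extends to paths by $g\,s(g)=r(g)$, $g|_{s(g)}=g$,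 $g(e\mu)=(ge)(g|_e\mu)$, $g|_{e\mu}=(g|_e)|_\mu$, and to infinite paths by $g(\mu_1\mu_2\cdots)=(g\mu_1)(g|_{\mu_1}\mu_2)(g|_{\mu_1\mu_2}\mu_3)\cdots$. A path $\mu\in s(g)E^*$ is strongly $g$-fixed if $g\mu=\mu$ and $g|_\mu=s(\mu)$; it is a minimal strongly $g$-fixed path if in addition no proper prefix of $\mu$ is strongly $g$-fixed. $E^{\le\infty}=E^*\cup E^\infty$; $Z(\alpha)$ is the set of elements of $E^{\le\infty}$ with prefix $\alpha$; the sets $Z(\alpha)\setminus\bigcup_{\beta\in F}Z(\alpha\beta)$ ($F\subseteq s(\alpha)E^*$ finite) form a basis of the topology. $\partial E=E^\infty\cup\{\mu\in E^*:s(\mu)\text{ singular}\}$. $\widetilde{\mathcal G}(G,E)$ consists of classes $[\alpha,g,\beta;\xi]$, where $\alpha,\beta\in E^*$, $g\in G$, $r(g)=s(\alpha)$, $s(g)=s(\beta)$, $\xi\in Z(\beta)$, and $[\alpha,g,\beta;\xi]=[\gamma,h,\delta;\eta]$ iff $\xi=\eta$ and there are $\beta',\delta'\in E^*$ with $\beta\beta'=\delta\delta'$ a prefix of $\xi$, $\alpha(g\beta')=\gamma(h\delta')$ and $g|_{\beta'}=h|_{\delta'}$. The source of $[\alpha,g,\beta;\beta\xi]$ is $\beta\xi$, its range is $\alpha(g\xi)$; products are $[s;\xi][t;\eta]=[st;\eta]$ (when composable), where $(\alpha,g,\beta)(\gamma,h,\delta)=(\alpha(g\beta'),g|_{\beta'}h,\delta)$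 if $\gamma=\beta\beta'$ and $=(\alpha,g(h^{-1}|_{\gamma'})^{-1},\delta(h^{-1}\gamma'))$ if $\beta=\gamma\gamma'$; the unit space is $E^{\le\infty}$; basic open sets are $\{[\alpha,g,\beta;\xi]:\xi\in V\}$, $V\subseteq Z(\beta)$ open. $\mathcal G(G,E)$ is its restriction to $\partial E$. $\widetilde{\mathcal G}_0(G,E)=\{[\alpha,g,\beta;\xi]:|\alpha|=|\beta|\}$, $\widetilde{\mathcal G}_{00}(G,E)=\{[g\beta,g|_\beta,\beta;\beta\xi]:s(g)=r(\beta),\ \xi\in s(\beta)E^{\le\infty}\}$, and $\mathcal G_0(G,E)$, $\mathcal G_{00}(G,E)$ are their intersections with $\mathcal G(G,E)$. All carry the subspace topology. *)

theory Defs
  imports "Graph_Theory.Digraph" "HOL-Analysis.Analysis"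
begin

section \<open>Groupoids\<close>

text \<open>
  A groupoid is given by its set of arrows; objects are identified with their identity
  arrows, so source and range map arrows to arrows. The product \<open>gmult G g h\<close> is meaningful
  only if \<open>gsrc G g = grng G h\<close>.
\<close>

record 'g pre_groupoid =
  arrows :: "'g set"
  gsrc :: "'g \<Rightarrow> 'g"
  grng :: "'g \<Rightarrow> 'g"
  gmult :: "'g \<Rightarrow> 'g \<Rightarrow> 'g"
  ginv :: "'g \<Rightarrow> 'g"

definition gunits :: "('g, 'z) pre_groupoid_scheme \<Rightarrow> 'g set" where
  "gunits G = gsrc G ` arrows G"

locale groupoid =
  fixes G :: "('g, 'z) pre_groupoid_scheme"
  assumes gsrc_closed: "g \<in> arrows G \<Longrightarrow> gsrc G g \<in> arrows G"
    and grng_closed: "g \<in> arrows G \<Longrightarrow> grng G g \<in> arrows G"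
    and gsrc_gsrc: "g \<in> arrows G \<Longrightarrow> gsrc G (gsrc G g) = gsrc G g"
    and grng_gsrc: "g \<in> arrows G \<Longrightarrow> grng G (gsrc G g) = gsrc G g"
    and gsrc_grng: "g \<in> arrows G \<Longrightarrow> gsrc G (grng G g) = grng G g"
    and grng_grng: "g \<in> arrows G \<Longrightarrow> grng G (grng G g) = grng G g"
    and gmult_closed:
      "\<lbrakk>g \<in> arrows G; h \<in> arrows G; gsrc G g = grng G h\<rbrakk> \<Longrightarrow> gmult G g h \<in> arrows G"
    and gsrc_gmult:
      "\<lbrakk>g \<in> arrows G; h \<in> arrows G; gsrc G g = grng G h\<rbrakk> \<Longrightarrow> gsrc G (gmult G g h) = gsrc G h"
    and grng_gmult:
      "\<lbrakk>g \<in> arrows G; h \<in> arrows G; gsrc G g = grng G h\<rbrakk> \<Longrightarrow> grng G (gmult G g h) = grng G g"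
    and gmult_assoc:
      "\<lbrakk>g \<in> arrows G; h \<in> arrows G; k \<in> arrows G; gsrc G g = grng G h; gsrc G h = grng G k\<rbrakk>
        \<Longrightarrow> gmult G (gmult G g h) k = gmult G g (gmult G h k)"
    and gmult_gsrc: "g \<in> arrows G \<Longrightarrow> gmult G g (gsrc G g) = g"
    and gmult_grng: "g \<in> arrows G \<Longrightarrow> gmult G (grng G g) g = g"
    and ginv_closed: "g \<in> arrows G \<Longrightarrow> ginv G g \<in> arrows G"
    and gsrc_ginv: "g \<in> arrows G \<Longrightarrow> gsrc G (ginv G g) = grng G g"
    and grng_ginv: "g \<in> arrows G \<Longrightarrow> grng G (ginv G g) = gsrc G g"
    and gmult_ginv_right: "g \<in> arrows G \<Longrightarrow> gmult G g (ginv G g) = grng G g"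
    and gmult_ginv_left: "g \<in> arrows G \<Longrightarrow> gmult G (ginv G g) g = gsrc G g"

definition restrict_arrows :: "'g pre_groupoid \<Rightarrow> 'g set \<Rightarrow> 'g pre_groupoid" where
  "restrict_arrows G A = G\<lparr>arrows := arrows G \<inter> A\<rparr>"

definition reduction :: "'g pre_groupoid \<Rightarrow> 'g set \<Rightarrow> 'g pre_groupoid" where
  "reduction G X = restrict_arrows G {g. gsrc G g \<in> X \<and> grng G g \<in> X}"

section \<open>Paths\<close>

text \<open>
  A finite path is a pair of its range vertex and its list of edges: the vertex \<open>v\<close> is
  \<open>(v, [])\<close>, and \<open>\<mu>\<^sub>1\<cdots>\<mu>\<^sub>n\<close> with \<open>n \<ge> 1\<close> is \<open>(r(\<mu>\<^sub>1), [\<mu>\<^sub>1, \<dots>, \<mu>\<^sub>n])\<close>.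
\<close>

type_synonym ('v, 'e) fpath = "'v \<times> 'e list"

datatype ('v, 'e) bpath = FinP "('v, 'e) fpath" | InfP "nat \<Rightarrow> 'e"

abbreviation prng :: "('v, 'e) fpath \<Rightarrow> 'v" where
  "prng \<equiv> fst"

definition plen :: "('v, 'e) fpath \<Rightarrow> nat" where
  "plen \<mu> = length (snd \<mu>)"

definition pcat :: "('v, 'e) fpath \<Rightarrow> ('v, 'e) fpath \<Rightarrow> ('v, 'e) fpath" where
  "pcat \<mu> \<nu> = (fst \<mu>, snd \<mu> @ snd \<nu>)"

fun bcat :: "('v, 'e) fpath \<Rightarrow> ('v, 'e) bpath \<Rightarrow> ('v, 'e) bpath" where
  "bcat \<mu> (FinP \<nu>) = FinP (pcat \<mu> \<nu>)"
| "bcat \<mu> (InfP x) =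
     InfP (\<lambda>n. if n < plen \<mu> then snd \<mu> ! n else x (n - plen \<mu>))"

type_synonym ('v, 'e, 'g) triple = "('v, 'e) fpath \<times> 'g \<times> ('v, 'e) fpath"

type_synonym ('v, 'e, 'g) germ = "(('v, 'e, 'g) triple \<times> ('v, 'e) bpath) set"

section \<open>Data of a self-similar action\<close>

text \<open>
  The source map of the graph is \<^const>\<open>tail\<close> and the range map is \<^const>\<open>head\<close>, so that
  consecutive edges of a path satisfy \<open>tail E \<mu>\<^sub>i = head E \<mu>\<^sub>i\<^sub>+\<^sub>1\<close> (the reverse of the order
  used for walks in \<^theory>\<open>Graph_Theory.Digraph\<close>). Vertices and arrows of the groupoid share
  the type \<open>'g\<close>, so that the vertex set can literally be the unit space. The action is
  \<open>act g e = ge\<close> and \<open>res g e = g|\<^sub>e\<close>; both are meaningful only if \<open>gsrc G g = head E e\<close>.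
\<close>

locale pre_self_similar =
  fixes E :: "('g, 'e) pre_digraph"
    and G :: "'g pre_groupoid"
    and act :: "'g \<Rightarrow> 'e \<Rightarrow> 'e"
    and res :: "'g \<Rightarrow> 'e \<Rightarrow> 'g"
begin

primrec is_path :: "'g \<Rightarrow> 'e list \<Rightarrow> bool" where
  "is_path v [] \<longleftrightarrow> v \<in> verts E"
| "is_path v (e # es) \<longleftrightarrow> e \<in> arcs E \<and> head E e = v \<and> is_path (tail E e) es"

definition fpaths :: "('g, 'e) fpath set" where
  "fpaths = {(v, es). is_path v es}"

definition psrc :: "('g, 'e) fpath \<Rightarrow> 'g" where
  "psrc \<mu> = (if snd \<mu> = [] then fst \<mu> else tail E (last (snd \<mu>)))"

definition infpaths :: "(nat \<Rightarrow> 'e) set" where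
  "infpaths = {x. \<forall>n. x n \<in> arcs E \<and> tail E (x n) = head E (x (Suc n))}"

definition bpaths :: "('g, 'e) bpath set" where
  "bpaths = FinP ` fpaths \<union> InfP ` infpaths"

fun brng :: "('g, 'e) bpath \<Rightarrow> 'g" where
  "brng (FinP \<mu>) = prng \<mu>"
| "brng (InfP x) = head E (x 0)"

definition pprefix :: "('g, 'e) fpath \<Rightarrow> ('g, 'e) fpath \<Rightarrow> bool" where
  "pprefix \<beta> \<alpha> \<longleftrightarrow> (\<exists>\<beta>'\<in>fpaths. prng \<beta>' = psrc \<beta> \<and> \<alpha> = pcat \<beta> \<beta>')"

definition singular :: "'g \<Rightarrow> bool" where
  "singular v \<longleftrightarrow> {e \<in> arcs E. head E e = v} = {} \<or> infinite {e \<in> arcs E. head E e = v}"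

definition boundary :: "('g, 'e) bpath set" where
  "boundary = InfP ` infpaths \<union> FinP ` {\<mu> \<in> fpaths. singular (psrc \<mu>)}"

definition cyl :: "('g, 'e) fpath \<Rightarrow> ('g, 'e) bpath set" where
  "cyl \<alpha> = {bcat \<alpha> \<xi> |\<xi>. \<xi> \<in> bpaths \<and> brng \<xi> = psrc \<alpha>}"

definition path_topology :: "('g, 'e) bpath topology" where
  "path_topology = topology_generated_by
     {cyl \<alpha> - (\<Union>\<beta>\<in>F. cyl (pcat \<alpha> \<beta>)) |\<alpha> F.
        \<alpha> \<in> fpaths \<and> finite F \<and> F \<subseteq> {\<beta> \<in> fpaths. prng \<beta> = psrc \<alpha>}}"

subsection \<open>The action on paths\<close>

primrec act_list :: "'g \<Rightarrow> 'e list \<Rightarrow> 'e list" where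
  "act_list g [] = []"
| "act_list g (e # es) = act g e # act_list (res g e) es"

primrec res_list :: "'g \<Rightarrow> 'e list \<Rightarrow> 'g" where
  "res_list g [] = g"
| "res_list g (e # es) = res_list (res g e) es"

definition pact :: "'g \<Rightarrow> ('g, 'e) fpath \<Rightarrow> ('g, 'e) fpath" where
  "pact g \<mu> = (grng G g, act_list g (snd \<mu>))"

definition pres :: "'g \<Rightarrow> ('g, 'e) fpath \<Rightarrow> 'g" where
  "pres g \<mu> = res_list g (snd \<mu>)"

fun bact :: "'g \<Rightarrow> ('g, 'e) bpath \<Rightarrow> ('g, 'e) bpath" where
  "bact g (FinP \<mu>) = FinP (pact g \<mu>)"
| "bact g (InfP x) = InfP (\<lambda>n. act (res_list g (map x [0..<n])) (x n))"

definition strongly_fixed :: "'g \<Rightarrow> ('g, 'e) fpath \<Rightarrow> bool" where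
  "strongly_fixed g \<mu> \<longleftrightarrow>
     \<mu> \<in> fpaths \<and> prng \<mu> = gsrc G g \<and> pact g \<mu> = \<mu> \<and> pres g \<mu> = psrc \<mu>"

definition minimal_strongly_fixed :: "'g \<Rightarrow> ('g, 'e) fpath \<Rightarrow> bool" where
  "minimal_strongly_fixed g \<mu> \<longleftrightarrow>
     strongly_fixed g \<mu> \<and> (\<forall>\<nu>\<in>fpaths. pprefix \<nu> \<mu> \<and> \<nu> \<noteq> \<mu> \<longrightarrow> \<not> strongly_fixed g \<nu>)"

definition cond_Fin :: bool where
  "cond_Fin \<longleftrightarrow> (\<forall>g\<in>arrows G. finite {\<mu>. minimal_strongly_fixed g \<mu>})"

subsection \<open>The groupoid of germs\<close>

definition triples :: "('g, 'e, 'g) triple set" where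
  "triples = {(\<alpha>, g, \<beta>).
     \<alpha> \<in> fpaths \<and> g \<in> arrows G \<and> \<beta> \<in> fpaths \<and> grng G g = psrc \<alpha> \<and> gsrc G g = psrc \<beta>}"

definition germ_reps :: "(('g, 'e, 'g) triple \<times> ('g, 'e) bpath) set" where
  "germ_reps = {((\<alpha>, g, \<beta>), \<xi>). (\<alpha>, g, \<beta>) \<in> triples \<and> \<xi> \<in> cyl \<beta>}"

definition germ_rel ::
  "((('g, 'e, 'g) triple \<times> ('g, 'e) bpath) \<times> (('g, 'e, 'g) triple \<times> ('g, 'e) bpath)) set" where
  "germ_rel = {(((\<alpha>, g, \<beta>), \<xi>), ((\<gamma>, h, \<delta>), \<eta>)).
     ((\<alpha>, g, \<beta>), \<xi>) \<in> germ_reps \<and> ((\<gamma>, h, \<delta>), \<eta>) \<in> germ_reps \<and> \<xi> = \<eta> \<and>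
     (\<exists>\<beta>'\<in>fpaths. \<exists>\<delta>'\<in>fpaths. prng \<beta>' = psrc \<beta> \<and> prng \<delta>' = psrc \<delta> \<and>
        pcat \<beta> \<beta>' = pcat \<delta> \<delta>' \<and> \<xi> \<in> cyl (pcat \<beta> \<beta>') \<and>
        pcat \<alpha> (pact g \<beta>') = pcat \<gamma> (pact h \<delta>') \<and> pres g \<beta>' = pres h \<delta>')}"

definition germ :: "('g, 'e, 'g) triple \<Rightarrow> ('g, 'e) bpath \<Rightarrow> ('g, 'e, 'g) germ" where
  "germ t \<xi> = germ_rel `` {(t, \<xi>)}"

definition germs :: "('g, 'e, 'g) germ set" where
  "germs = germ_reps // germ_rel"

definition germ_topology :: "('g, 'e, 'g) germ topology" where
  "germ_topology = topology_generated_by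
     {germ (\<alpha>, g, \<beta>) ` V |\<alpha> g \<beta> V.
        (\<alpha>, g, \<beta>) \<in> triples \<and> V \<subseteq> cyl \<beta> \<and> openin path_topology V}"

text \<open>Source and range of a germ as elements of the unit space \<open>E\<^sup>\<le>\<^sup>\<infinity>\<close>.\<close>

definition germ_source :: "('g, 'e, 'g) germ \<Rightarrow> ('g, 'e) bpath" where
  "germ_source X = (THE \<xi>. \<exists>t. (t, \<xi>) \<in> X)"

definition germ_range :: "('g, 'e, 'g) germ \<Rightarrow> ('g, 'e) bpath" where
  "germ_range X = (THE \<eta>. \<exists>\<alpha> g \<beta> \<xi>. \<xi> \<in> bpaths \<and> brng \<xi> = psrc \<beta> \<and>
     ((\<alpha>, g, \<beta>), bcat \<beta> \<xi>) \<in> X \<and> \<eta> = bcat \<alpha> (bact g \<xi>))"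

text \<open>The unit \<open>\<xi>\<close> with range vertex \<open>v\<close> is identified with the germ \<open>[v, v, v; \<xi>]\<close>.\<close>

definition unit_germ :: "('g, 'e) bpath \<Rightarrow> ('g, 'e, 'g) germ" where
  "unit_germ \<xi> = germ ((brng \<xi>, []), brng \<xi>, (brng \<xi>, [])) \<xi>"

inductive triple_mult ::
  "('g, 'e, 'g) triple \<Rightarrow> ('g, 'e, 'g) triple \<Rightarrow> ('g, 'e, 'g) triple \<Rightarrow> bool" where
  "\<lbrakk>\<beta>' \<in> fpaths; prng \<beta>' = psrc \<beta>; \<gamma> = pcat \<beta> \<beta>'\<rbrakk> \<Longrightarrow>
     triple_mult (\<alpha>, g, \<beta>) (\<gamma>, h, \<delta>) (pcat \<alpha> (pact g \<beta>'), gmult G (pres g \<beta>') h, \<delta>)"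
| "\<lbrakk>\<gamma>' \<in> fpaths; prng \<gamma>' = psrc \<gamma>; \<beta> = pcat \<gamma> \<gamma>'\<rbrakk> \<Longrightarrow>
     triple_mult (\<alpha>, g, \<beta>) (\<gamma>, h, \<delta>)
       (\<alpha>, gmult G g (ginv G (pres (ginv G h) \<gamma>')), pcat \<delta> (pact (ginv G h) \<gamma>'))"

definition germ_mult ::
  "('g, 'e, 'g) germ \<Rightarrow> ('g, 'e, 'g) germ \<Rightarrow> ('g, 'e, 'g) germ" where
  "germ_mult X Y = (THE Z. \<exists>t \<xi> u \<eta> w.
     (t, \<xi>) \<in> X \<and> (u, \<eta>) \<in> Y \<and> triple_mult t u w \<and> Z = germ w \<eta>)"

definition germ_inv :: "('g, 'e, 'g) germ \<Rightarrow> ('g, 'e, 'g) germ" where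
  "germ_inv X = (THE Z. \<exists>\<alpha> g \<beta> \<xi>.
     ((\<alpha>, g, \<beta>), \<xi>) \<in> X \<and> Z = germ (\<beta>, ginv G g, \<alpha>) (germ_range X))"

text \<open>
  The groupoids \<open>tG\<close>, \<open>tG0\<close>, \<open>tG00\<close> have unit space \<open>E\<^sup>\<le>\<^sup>\<infinity>\<close>; \<open>bG\<close>, \<open>bG0\<close>, \<open>bG00\<close> are
  the corresponding groupoids over the boundary.
\<close>

definition tG :: "('g, 'e, 'g) germ pre_groupoid" where
  "tG = \<lparr>arrows = germs,
         gsrc = (\<lambda>X. unit_germ (germ_source X)),
         grng = (\<lambda>X. unit_germ (germ_range X)),
         gmult = germ_mult,
         ginv = germ_inv\<rparr>"

definition tG0 :: "('g, 'e, 'g) germ pre_groupoid" where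
  "tG0 = restrict_arrows tG
     {germ (\<alpha>, g, \<beta>) \<xi> |\<alpha> g \<beta> \<xi>. ((\<alpha>, g, \<beta>), \<xi>) \<in> germ_reps \<and> plen \<alpha> = plen \<beta>}"

definition tG00 :: "('g, 'e, 'g) germ pre_groupoid" where
  "tG00 = restrict_arrows tG
     {germ (pact g \<beta>, pres g \<beta>, \<beta>) (bcat \<beta> \<xi>) |g \<beta> \<xi>.
        g \<in> arrows G \<and> \<beta> \<in> fpaths \<and> gsrc G g = prng \<beta> \<and> \<xi> \<in> bpaths \<and> brng \<xi> = psrc \<beta>}"

definition bG :: "('g, 'e, 'g) germ pre_groupoid" where
  "bG = reduction tG (unit_germ ` boundary)"

definition bG0 :: "('g, 'e, 'g) germ pre_groupoid" where
  "bG0 = restrict_arrows tG0 (arrows bG)"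

definition bG00 :: "('g, 'e, 'g) germ pre_groupoid" where
  "bG00 = restrict_arrows tG00 (arrows bG)"

definition hausdorff_germs :: "('g, 'e, 'g) germ pre_groupoid \<Rightarrow> bool" where
  "hausdorff_germs H \<longleftrightarrow> Hausdorff_space (subtopology germ_topology (arrows H))"

end

locale self_similar_action =
  wf_digraph E + groupoid G + pre_self_similar E G act res
  for E :: "('g, 'e) pre_digraph" and G :: "'g pre_groupoid"
    and act :: "'g \<Rightarrow> 'e \<Rightarrow> 'e" and res :: "'g \<Rightarrow> 'e \<Rightarrow> 'g" +
  assumes gunits_eq_verts: "gunits G = verts E"
    and act_closed:
      "\<lbrakk>g \<in> arrows G; e \<in> arcs E; gsrc G g = head E e\<rbrakk> \<Longrightarrow> act g e \<in> arcs E"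
    and head_act:
      "\<lbrakk>g \<in> arrows G; e \<in> arcs E; gsrc G g = head E e\<rbrakk> \<Longrightarrow> head E (act g e) = grng G g"
    and act_gmult:
      "\<lbrakk>h \<in> arrows G; g \<in> arrows G; gsrc G h = grng G g; e \<in> arcs E; gsrc G g = head E e\<rbrakk>
        \<Longrightarrow> act (gmult G h g) e = act h (act g e)"
    and act_unit: "e \<in> arcs E \<Longrightarrow> act (head E e) e = e"
    and res_closed:
      "\<lbrakk>g \<in> arrows G; e \<in> arcs E; gsrc G g = head E e\<rbrakk> \<Longrightarrow> res g e \<in> arrows G"
    and gsrc_res:
      "\<lbrakk>g \<in> arrows G; e \<in> arcs E; gsrc G g = head E e\<rbrakk> \<Longrightarrow> gsrc G (res g e) = tail E e"
    and grng_res: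
      "\<lbrakk>g \<in> arrows G; e \<in> arcs E; gsrc G g = head E e\<rbrakk> \<Longrightarrow> grng G (res g e) = tail E (act g e)"
    and res_gmult:
      "\<lbrakk>h \<in> arrows G; g \<in> arrows G; gsrc G h = grng G g; e \<in> arcs E; gsrc G g = head E e\<rbrakk>
        \<Longrightarrow> res (gmult G h g) e = gmult G (res h (act g e)) (res g e)"

end

theory Submission
  imports Defs "HOL-Library.Sublist"
begin

text \<open>
  Two germs \<open>[\<alpha>, g, \<beta>; \<xi>]\<close> and \<open>[\<alpha>, h, \<beta>; \<xi>]\<close> coincide iff \<open>\<xi>\<close> has a prefix \<open>\<beta>\<mu>\<close> with \<open>\<mu>\<close>
  strongly fixed by \<open>k = h\<inverse>g\<close>, and then \<open>\<mu>\<close> may be taken minimal. So if \<open>k\<close> has only finitely many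
  minimal strongly fixed paths \<open>\<mu>\<close>, distinct germs are separated over the open set obtained from
  \<open>Z(\<beta>)\<close> by removing the cylinders \<open>Z(\<beta>\<mu>)\<close>; this makes the largest of the six groupoids
  Hausdorff.
  Conversely, infinitely many minimal strongly \<open>g\<close>-fixed paths with range \<open>v\<close> accumulate at some
  boundary path \<open>\<xi>\<close>, no prefix of which is strongly fixed. The germs \<open>[v, g, v; \<xi>]\<close> and
  \<open>[v, v, v; \<xi>]\<close> are then distinct, but \<open>[v, g, v; \<eta>] = [v, v, v; \<eta>]\<close> for boundary paths \<open>\<eta>\<close>
  arbitrarily close to \<open>\<xi>\<close>, so that the smallest of the six groupoids is not Hausdorff.
\<close>

context self_similar_action
begin

section \<open>Units and restrictions along paths\<close>

lemma vert_unit: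
  assumes "v \<in> verts E"
  shows "v \<in> arrows G" "gsrc G v = v" "grng G v = v" "gmult G v v = v"
proof -
  obtain k where k: "k \<in> arrows G" "v = gsrc G k"
    using assms gunits_eq_verts unfolding gunits_def by auto
  show "v \<in> arrows G" "gsrc G v = v" "grng G v = v"
    using k gsrc_closed gsrc_gsrc grng_gsrc by auto
  then show "gmult G v v = v"
    by (metis gmult_gsrc)
qed

lemma gsrc_vert: "g \<in> arrows G \<Longrightarrow> gsrc G g \<in> verts E"
  using gunits_eq_verts unfolding gunits_def by auto

lemma grng_vert: "g \<in> arrows G \<Longrightarrow> grng G g \<in> verts E"
  using gsrc_vert[of "grng G g"] grng_closed gsrc_grng by simp

lemma psrc_Nil [simp]: "psrc (v, []) = v"
  by (simp add: psrc_def)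

lemma psrc_Cons [simp]: "psrc (v, e # l) = psrc (tail E e, l)"
  by (simp add: psrc_def)

lemma psrc_append [simp]: "psrc (v, l @ m) = psrc (psrc (v, l), m)"
  by (induction l arbitrary: v) auto

lemma is_path_append [simp]: "is_path v (l @ m) \<longleftrightarrow> is_path v l \<and> is_path (psrc (v, l)) m"
proof -
  have "is_path v m \<Longrightarrow> v \<in> verts E" for v m
    by (cases m) (auto simp: head_in_verts)
  then show ?thesis
    by (induction l arbitrary: v) auto
qed

lemma is_path_verts: "is_path v l \<Longrightarrow> v \<in> verts E"
  by (cases l) (auto simp: head_in_verts)

lemma psrc_verts: "is_path v l \<Longrightarrow> psrc (v, l) \<in> verts E"
  by (induction l arbitrary: v) auto

lemma mem_fpaths [simp]: "(v, l) \<in> fpaths \<longleftrightarrow> is_path v l"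
  by (simp add: fpaths_def)

lemma act_list_append: "act_list g (l @ m) = act_list g l @ act_list (res_list g l) m"
  by (induction l arbitrary: g) auto

lemma res_list_append: "res_list g (l @ m) = res_list (res_list g l) m"
  by (induction l arbitrary: g) auto

lemma length_act_list [simp]: "length (act_list g l) = length l"
  by (induction l arbitrary: g) auto

lemma action_on_path:
  assumes "g \<in> arrows G" "is_path (gsrc G g) l"
  shows "is_path (grng G g) (act_list g l) \<and> res_list g l \<in> arrows G \<and>
    gsrc G (res_list g l) = psrc (gsrc G g, l) \<and>
    grng G (res_list g l) = psrc (grng G g, act_list g l)"
  using assms
proof (induction l arbitrary: g)
  case Nil
  then show ?case by (simp add: grng_vert)
next
  case (Cons e l)
  then have e: "e \<in> arcs E" "gsrc G g = head E e" "is_path (tail E e) l"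
    by auto
  show ?case
    using Cons.IH[of "res g e"] e Cons.prems(1)
    by (simp add: res_closed gsrc_res grng_res act_closed head_act)
qed

text \<open>A vertex is its own square, so \<open>res_gmult\<close> makes its restriction an
  idempotent loop; cancelling in the groupoid shows that an idempotent is a unit.\<close>

lemma res_unit:
  assumes e: "e \<in> arcs E"
  shows "res (head E e) e = tail E e"
proof -
  define a where "a = res (head E e) e"
  have v: "head E e \<in> verts E" using e by simp
  note u = vert_unit[OF v]
  have a: "a \<in> arrows G" "gsrc G a = tail E e" "grng G a = tail E e"
    unfolding a_def using res_closed gsrc_res grng_res u e act_unit by auto
  have aa: "gmult G a a = a"
    using res_gmult[of "head E e" "head E e" e] u e act_unit[OF e] unfolding a_def by simp
  have "a = gmult G (gmult G (ginv G a) a) a"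
    using a gmult_ginv_left gmult_grng by metis
  also have "\<dots> = gmult G (ginv G a) (gmult G a a)"
    using a by (intro gmult_assoc) (auto simp: ginv_closed gsrc_ginv)
  also have "\<dots> = gsrc G a"
    using aa a gmult_ginv_left by simp
  finally show ?thesis using a(2) a_def by simp
qed

lemma unit_action:
  assumes "is_path v l"
  shows "act_list v l = l \<and> res_list v l = psrc (v, l)"
  using assms by (induction l arbitrary: v) (auto simp: act_unit res_unit)

lemma mult_action:
  assumes "h \<in> arrows G" "g \<in> arrows G" "gsrc G h = grng G g" "is_path (gsrc G g) l"
  shows "act_list (gmult G h g) l = act_list h (act_list g l) \<and>
    res_list (gmult G h g) l = gmult G (res_list h (act_list g l)) (res_list g l)"
  using assms
proof (induction l arbitrary: g h)
  case Nil
  then show ?case by simp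
next
  case (Cons e l)
  then have e: "e \<in> arcs E" "gsrc G g = head E e" "is_path (tail E e) l"
    by auto
  then have h: "gsrc G h = head E (act g e)" "act g e \<in> arcs E"
    using Cons.prems by (auto simp: head_act act_closed)
  show ?case
    using Cons.IH[of "res h (act g e)" "res g e"] e h Cons.prems(1,2,3)
    by (simp add: res_closed gsrc_res grng_res act_gmult res_gmult)
qed

section \<open>Strongly fixed paths and agreement of two groupoid elements\<close>

lemma strongly_fixed_iff:
  "strongly_fixed k (v, l) \<longleftrightarrow>
    is_path v l \<and> gsrc G k = v \<and> grng G k = v \<and> act_list k l = l \<and> res_list k l = psrc (v, l)"
  by (auto simp: strongly_fixed_def pact_def pres_def)

text \<open>Multiplying by \<open>ginv G h\<close> turns agreement of \<open>g\<close> and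
  \<open>h\<close> along \<open>l\<close> into triviality of h^-1 g there, and multiplying by
  \<open>h\<close> turns it back. Hence comparing two elements becomes a property of a single one,
  to which (Fin) applies.\<close>

lemma agree_iff_strongly_fixed:
  assumes g: "g \<in> arrows G" and h: "h \<in> arrows G"
    and s: "gsrc G g = gsrc G h" and r: "grng G g = grng G h"
    and l: "is_path (gsrc G g) l"
  shows "act_list g l = act_list h l \<and> res_list g l = res_list h l \<longleftrightarrow>
    strongly_fixed (gmult G (ginv G h) g) (gsrc G g, l)"
proof -
  define k where "k = gmult G (ginv G h) g"
  have i: "ginv G h \<in> arrows G" "gsrc G (ginv G h) = grng G g" "grng G (ginv G h) = gsrc G g"
    using h s r by (auto simp: ginv_closed gsrc_ginv grng_ginv)
  have k: "k \<in> arrows G" "gsrc G k = gsrc G g" "grng G k = gsrc G g"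
    unfolding k_def using g i by (auto simp: gmult_closed gsrc_gmult grng_gmult)
  have hk: "gmult G h k = g"
    using gmult_assoc[of h "ginv G h" g] g h i r
    by (simp add: k_def gmult_ginv_right gmult_grng s) (metis gmult_grng)
  have kl: "act_list k l = act_list (ginv G h) (act_list g l)"
    "res_list k l = gmult G (res_list (ginv G h) (act_list g l)) (res_list g l)"
    using mult_action[of "ginv G h" g l] i g l k_def by auto
  have ihl: "act_list (ginv G h) (act_list h l) = l"
    "gmult G (res_list (ginv G h) (act_list h l)) (res_list h l) = psrc (gsrc G g, l)"
    using mult_action[of "ginv G h" h l] unit_action[of "gsrc G h" l] i h l s r
    by (auto simp: gmult_ginv_left)
  have gl: "act_list g l = act_list h (act_list k l)"
    "res_list g l = gmult G (res_list h (act_list k l)) (res_list k l)"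
    using mult_action[of h k l] h k l hk s by auto
  have hl: "gmult G (res_list h l) (psrc (gsrc G g, l)) = res_list h l"
    using action_on_path[of h l] h l s gmult_gsrc[of "res_list h l"] by simp
  show ?thesis
    using kl ihl gl hl k l unfolding k_def[symmetric] strongly_fixed_iff by metis
qed

text \<open>Descent on length: a strongly fixed path that is not minimal has a strictly shorter
  strongly fixed prefix.\<close>

lemma strongly_fixed_minimal_prefix:
  assumes "strongly_fixed k (v, l)"
  shows "\<exists>m. prefix m l \<and> minimal_strongly_fixed k (v, m)"
  using assms
proof (induction l rule: length_induct)
  case (1 l)
  show ?case
  proof (cases "minimal_strongly_fixed k (v, l)")
    case False
    then obtain w m where m: "pprefix (w, m) (v, l)" "(w, m) \<noteq> (v, l)" "strongly_fixed k (w, m)"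
      using 1(2) unfolding minimal_strongly_fixed_def by auto
    then have "w = v" "prefix m l" "m \<noteq> l"
      by (auto simp: pprefix_def pcat_def)
    moreover from this have "length m < length l"
      by (metis prefix_length_less prefix_order.less_le)
    ultimately show ?thesis
      using 1(1) m(3) by (meson prefix_order.trans)
  qed auto
qed

lemma minimal_strongly_fixed_unique:
  assumes "minimal_strongly_fixed k (v, l)" "strongly_fixed k (v, m)" "prefix m l"
  shows "m = l"
proof (rule ccontr)
  assume "m \<noteq> l"
  obtain z where z: "l = m @ z" using assms(3) by (auto simp: prefix_def)
  have "is_path v l" using assms(1) by (simp add: minimal_strongly_fixed_def strongly_fixed_iff)
  then have "pprefix (v, m) (v, l)"
    using z by (auto simp: pprefix_def pcat_def intro!: bexI[of _ "(psrc (v, m), z)"])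
  then show False
    using assms \<open>m \<noteq> l\<close> by (auto simp: minimal_strongly_fixed_def strongly_fixed_iff)
qed

section \<open>The path space\<close>

text \<open>Prefixes are recorded by edge lists alone; the range vertex is supplied separately by
  \<open>brng\<close>. In particular the empty list is a prefix of every path.\<close>

fun bprefix :: "'e list \<Rightarrow> ('g, 'e) bpath \<Rightarrow> bool" where
  "bprefix l (FinP \<mu>) \<longleftrightarrow> prefix l (snd \<mu>)"
| "bprefix l (InfP x) \<longleftrightarrow> (\<exists>n. l = map x [0..<n])"

lemma bprefix_Nil [simp]: "bprefix [] \<xi>"
  by (cases \<xi>) auto

lemma prefix_map_upt: "prefix l (map x [0..<n]) \<longleftrightarrow> (\<exists>m\<le>n. l = map x [0..<m])"
proof
  assume p: "prefix l (map x [0..<n])"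
  then have le: "length l \<le> n" using prefix_length_le by fastforce
  have "l = take (length l) (map x [0..<n])" using p by (auto simp: prefix_def)
  also have "\<dots> = map x [0..<length l]" using le by (simp add: take_map)
  finally show "\<exists>m\<le>n. l = map x [0..<m]" using le by blast
next
  assume "\<exists>m\<le>n. l = map x [0..<m]"
  then obtain m where "m \<le> n" "l = map x [0..<m]" by blast
  then have "map x [0..<n] = l @ map x [m..<n]"
    by (metis le_add_diff_inverse map_append upt_add_eq_append zero_le)
  then show "prefix l (map x [0..<n])" by (rule prefixI)
qed

lemma bprefix_linear:
  assumes "bprefix l \<xi>" "bprefix m \<xi>" "length l \<le> length m"
  shows "prefix l m"
proof (cases \<xi>)
  case (FinP \<mu>)
  then show ?thesis using assms by (auto intro: prefix_length_prefix)
next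
  case (InfP x)
  then show ?thesis using assms by (auto simp: prefix_map_upt)
qed

lemma bprefix_prefix:
  assumes "prefix l m" "bprefix m \<xi>"
  shows "bprefix l \<xi>"
proof (cases \<xi>)
  case (FinP \<mu>)
  then show ?thesis using assms by auto
next
  case (InfP x)
  then show ?thesis using assms by (auto simp: prefix_map_upt)
qed

lemma bprefix_bcat [simp]: "bprefix l (bcat (v, l) \<xi>)"
proof (cases \<xi>)
  case (InfP x)
  have "l = map (\<lambda>n. if n < length l then l ! n else x (n - length l)) [0..<length l]"
    by (rule nth_equalityI) auto
  then have "\<exists>k. l = map (\<lambda>n. if n < length l then l ! n else x (n - length l)) [0..<k]" ..
  then show ?thesis unfolding InfP bcat.simps bprefix.simps plen_def snd_conv .
qed (auto simp: pcat_def)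

lemma infpath_is_path:
  assumes "x \<in> infpaths"
  shows "is_path (head E (x 0)) (map x [0..<n]) \<and> psrc (head E (x 0), map x [0..<n]) = head E (x n)"
proof (induction n)
  case (Suc n)
  moreover have "x n \<in> arcs E" "tail E (x n) = head E (x (Suc n))"
    using assms by (auto simp: infpaths_def)
  moreover have "x (Suc n) \<in> arcs E" using assms by (auto simp: infpaths_def)
  ultimately show ?case by (auto simp: head_in_verts)
qed (use assms in \<open>auto simp: infpaths_def head_in_verts\<close>)

lemma bpath_is_path:
  assumes "\<xi> \<in> bpaths" "bprefix l \<xi>"
  shows "is_path (brng \<xi>) l"
proof (cases \<xi>)
  case (FinP \<mu>)
  then show ?thesis using assms by (cases \<mu>) (auto simp: bpaths_def prefix_def)
next
  case (InfP x)
  then show ?thesis using assms infpath_is_path[of x] by (auto simp: bpaths_def)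
qed

lemma bcat_bpath:
  assumes "is_path v l" "\<xi> \<in> bpaths" "brng \<xi> = psrc (v, l)"
  shows "bcat (v, l) \<xi> \<in> bpaths \<and> brng (bcat (v, l) \<xi>) = v"
proof (cases \<xi>)
  case (FinP \<mu>)
  then show ?thesis using assms by (cases \<mu>) (auto simp: bpaths_def pcat_def)
next
  case (InfP x)
  define y where "y = (\<lambda>n. if n < length l then l ! n else x (n - length l))"
  have x: "x n \<in> arcs E" "tail E (x n) = head E (x (Suc n))" "psrc (v, l) = head E (x 0)" for n
    using assms(2,3) InfP by (auto simp: bpaths_def infpaths_def)
  have y: "(\<forall>n. y n \<in> arcs E \<and> tail E (y n) = head E (y (Suc n))) \<and> head E (y 0) = v"
    using assms(1) x(3) unfolding y_def
  proof (induction l arbitrary: v)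
    case Nil
    then show ?case using x(1,2) by simp
  next
    case (Cons e l)
    define z where "z = (\<lambda>n. if n < length l then l ! n else x (n - length l))"
    have z: "(\<forall>n. z n \<in> arcs E \<and> tail E (z n) = head E (z (Suc n))) \<and> head E (z 0) = tail E e"
      using Cons.IH[of "tail E e"] Cons.prems unfolding z_def by simp
    \<comment> \<open>Prepending \<open>e\<close> shifts the sequence by one index, so the only new
      condition is the junction of \<open>e\<close> and \<open>z\<close> at index 0.\<close>
    have cases: "(if n < length (e # l) then (e # l) ! n else x (n - length (e # l))) =
        (case n of 0 \<Rightarrow> e | Suc m \<Rightarrow> z m)" for n
      by (auto simp: z_def split: nat.split)
    then show ?case
      unfolding cases using z Cons.prems by (simp split: nat.split)
  qed
  have "bcat (v, l) \<xi> = InfP y"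
    unfolding InfP bcat.simps plen_def snd_conv y_def ..
  moreover have "y \<in> infpaths" using y unfolding infpaths_def by blast
  ultimately show ?thesis using y by (simp add: bpaths_def)
qed

lemma bcat_surj:
  assumes "\<xi> \<in> bpaths" "bprefix l \<xi>"
  shows "\<exists>\<zeta>\<in>bpaths. brng \<zeta> = psrc (brng \<xi>, l) \<and> \<xi> = bcat (brng \<xi>, l) \<zeta>"
proof (cases \<xi>)
  case (FinP \<mu>)
  then obtain z where z: "snd \<mu> = l @ z" using assms(2) by (auto simp: prefix_def)
  then show ?thesis
    using assms(1) FinP
    by (cases \<mu>) (auto simp: bpaths_def pcat_def intro!: bexI[of _ "FinP (psrc (brng \<xi>, l), z)"])
next
  case (InfP x)
  then obtain k where l: "l = map x [0..<k]" and x: "x \<in> infpaths"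
    using assms by (auto simp: bpaths_def)
  define y where "y n = x (n + k)" for n
  have "y \<in> infpaths" using x by (auto simp: y_def infpaths_def)
  moreover have "head E (y 0) = psrc (brng \<xi>, l)"
    using infpath_is_path[OF x, of k] l InfP by (simp add: y_def)
  moreover have "\<xi> = bcat (brng \<xi>, l) (InfP y)"
    using InfP l by (auto simp: y_def plen_def fun_eq_iff)
  ultimately show ?thesis
    by (intro bexI[of _ "InfP y"]) (auto simp: bpaths_def)
qed

text \<open>By \<open>bcat_surj\<close> every prefix can be split off, so topological arguments can
  work with ranges and prefixes in place of concatenations.\<close>

lemma mem_cyl_iff:
  assumes "is_path v l"
  shows "\<xi> \<in> cyl (v, l) \<longleftrightarrow> \<xi> \<in> bpaths \<and> brng \<xi> = v \<and> bprefix l \<xi>"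
  using assms bcat_bpath bcat_surj[of \<xi> l] unfolding cyl_def by auto

text \<open>A finite path has prefixes of bounded length and is its own longest one, while an
  infinite path is read off from its prefixes of length \<open>Suc n\<close>.\<close>

lemma bpath_eqI:
  assumes "\<xi> \<in> bpaths" "\<eta> \<in> bpaths" "brng \<xi> = brng \<eta>" "\<And>l. bprefix l \<xi> \<longleftrightarrow> bprefix l \<eta>"
  shows "\<xi> = \<eta>"
proof -
  have ne: "\<exists>l. bprefix l (InfP x) \<and> \<not> bprefix l (FinP \<mu>)" for x and \<mu> :: "('g, 'e) fpath"
  proof -
    have "\<not> prefix (map x [0..<Suc (length (snd \<mu>))]) (snd \<mu>)"
      by (auto dest: prefix_length_le)
    then show ?thesis unfolding bprefix.simps by blast
  qed
  have inf: "x = y" if *: "\<And>l. bprefix l (InfP x) \<longleftrightarrow> bprefix l (InfP y)" for x y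
  proof
    fix n
    obtain k where k: "map x [0..<Suc n] = map y [0..<k]"
      using *[of "map x [0..<Suc n]"] unfolding bprefix.simps by blast
    then have "k = Suc n" by (metis length_map length_upt diff_zero)
    then show "x n = y n" using k by simp
  qed
  show ?thesis
  proof (cases \<xi>)
    case (FinP \<mu>)
    then obtain \<nu> where \<nu>: "\<eta> = FinP \<nu>"
      using ne assms(4) by (metis bpath.exhaust)
    then have "prefix (snd \<mu>) (snd \<nu>)" "prefix (snd \<nu>) (snd \<mu>)"
      using assms(4)[of "snd \<mu>"] assms(4)[of "snd \<nu>"] FinP by auto
    then show ?thesis
      using FinP \<nu> assms(3) by (auto simp: prod_eq_iff)
  next
    case (InfP x)
    then obtain y where "\<eta> = InfP y"
      using ne assms(4) by (metis bpath.exhaust)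
    then show ?thesis
      using inf[of x y] InfP assms(4) by simp
  qed
qed

text \<open>\<open>pcat\<close> discards the vertex of its second argument, so for finite paths it
  is the equality of ranges that recovers this vertex.\<close>

lemma bcat_inject:
  assumes "bcat \<beta> \<zeta> = bcat \<beta> \<zeta>'" "brng \<zeta> = brng \<zeta>'"
  shows "\<zeta> = \<zeta>'"
proof (cases \<zeta>)
  case (FinP \<mu>)
  then show ?thesis using assms by (cases \<zeta>') (auto simp: pcat_def prod_eq_iff)
next
  case (InfP x)
  then obtain y where y: "\<zeta>' = InfP y" using assms(1) by (cases \<zeta>') auto
  have "x n = y n" for n
  proof -
    have "bcat \<beta> (InfP x) = bcat \<beta> (InfP y)" using assms(1) InfP y by simp
    then have "(if n + plen \<beta> < plen \<beta> then snd \<beta> ! (n + plen \<beta>) else x (n + plen \<beta> - plen \<beta>)) =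
      (if n + plen \<beta> < plen \<beta> then snd \<beta> ! (n + plen \<beta>) else y (n + plen \<beta> - plen \<beta>))"
      unfolding bcat.simps bpath.inject by (rule fun_cong)
    then show ?thesis by simp
  qed
  then show ?thesis using InfP y by (simp add: fun_eq_iff)
qed

section \<open>Cylinder topology on the path space\<close>

lemma openin_cyl_diff:
  assumes "\<alpha> \<in> fpaths" "finite F" "F \<subseteq> {\<beta> \<in> fpaths. prng \<beta> = psrc \<alpha>}"
  shows "openin path_topology (cyl \<alpha> - (\<Union>\<beta>\<in>F. cyl (pcat \<alpha> \<beta>)))"
  unfolding path_topology_def by (rule topology_generated_by_Basis) (use assms in blast)

lemma openin_cyl: "\<alpha> \<in> fpaths \<Longrightarrow> openin path_topology (cyl \<alpha>)"
  using openin_cyl_diff[of \<alpha> "{}"] by simp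

text \<open>The cylinder of \<open>l\<close> and its complement in the cylinder of the common range
  vertex are both basic open sets.\<close>

lemma separate_bprefix:
  assumes "\<xi> \<in> bpaths" "\<eta> \<in> bpaths" "brng \<xi> = brng \<eta>" "bprefix l \<xi>" "\<not> bprefix l \<eta>"
  shows "\<exists>U V. openin path_topology U \<and> openin path_topology V \<and> \<xi> \<in> U \<and> \<eta> \<in> V \<and> U \<inter> V = {}"
proof -
  define v where "v = brng \<xi>"
  have l: "is_path v l" "v \<in> verts E"
    using assms bpath_is_path is_path_verts v_def by blast+
  have "openin path_topology (cyl (v, []) - (\<Union>\<beta>\<in>{(v, l)}. cyl (pcat (v, []) \<beta>)))"
    by (rule openin_cyl_diff) (use l in auto)
  then have "openin path_topology (cyl (v, []) - cyl (v, l))" by (simp add: pcat_def)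
  moreover have "openin path_topology (cyl (v, l))" using l by (simp add: openin_cyl)
  moreover have "\<xi> \<in> cyl (v, l)" "\<eta> \<in> cyl (v, []) - cyl (v, l)"
    using assms l by (auto simp: mem_cyl_iff v_def)
  ultimately show ?thesis by blast
qed

text \<open>Paths with different ranges lie in disjoint vertex cylinders; otherwise some finite
  prefix belongs to only one of them.\<close>

lemma path_space_Hausdorff:
  assumes "\<xi> \<in> bpaths" "\<eta> \<in> bpaths" "\<xi> \<noteq> \<eta>"
  shows "\<exists>U V. openin path_topology U \<and> openin path_topology V \<and> \<xi> \<in> U \<and> \<eta> \<in> V \<and> U \<inter> V = {}"
proof (cases "brng \<xi> = brng \<eta>")
  case True
  then obtain l where "bprefix l \<xi> \<noteq> bprefix l \<eta>"
    using bpath_eqI assms by blast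
  then consider "bprefix l \<xi>" "\<not> bprefix l \<eta>" | "bprefix l \<eta>" "\<not> bprefix l \<xi>" by blast
  then show ?thesis
  proof cases
    case 1
    then show ?thesis using separate_bprefix assms True by metis
  next
    case 2
    then show ?thesis using separate_bprefix[of \<eta> \<xi> l] assms True by (metis Int_commute)
  qed
next
  case False
  have v: "is_path (brng \<xi>) []" "is_path (brng \<eta>) []"
    using bpath_is_path assms bprefix_Nil by blast+
  have "\<xi> \<in> cyl (brng \<xi>, [])" "\<eta> \<in> cyl (brng \<eta>, [])" "cyl (brng \<xi>, []) \<inter> cyl (brng \<eta>, []) = {}"
    using False assms(1,2) by (auto simp only: mem_cyl_iff[OF v(1)] mem_cyl_iff[OF v(2)] bprefix_Nil)
  moreover have "openin path_topology (cyl (brng \<xi>, []))" "openin path_topology (cyl (brng \<eta>, []))"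
    using v openin_cyl mem_fpaths by blast+
  ultimately show ?thesis by blast
qed

section \<open>Germs\<close>

text \<open>
  The germ of \<open>(\<alpha>, g, \<beta>)\<close> at \<open>\<xi>\<close> is also represented by \<open>(\<alpha>(g\<beta>'), g|\<^sub>\<beta>\<^sub>', \<beta>\<beta>')\<close> for every
  prefix \<open>\<beta>\<beta>'\<close> of \<open>\<xi>\<close>. With \<open>l\<close> the edge list of \<open>\<beta>\<beta>'\<close>, \<open>expand\<close> computes the first two components
  (the first as a pair); two germs at \<open>\<xi>\<close> agree iff these data agree for some prefix \<open>l\<close> of \<open>\<xi>\<close>.
\<close>

abbreviation domain_length :: "('g, 'e, 'g) triple \<Rightarrow> nat" where
  "domain_length t \<equiv> plen (snd (snd t))"

definition expand :: "('g, 'e, 'g) triple \<Rightarrow> 'e list \<Rightarrow> 'g \<times> 'e list \<times> 'g" where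
  "expand t l = (case t of (\<alpha>, g, \<beta>) \<Rightarrow> let b = drop (plen \<beta>) l in
     (fst \<alpha>, snd \<alpha> @ act_list g b, res_list g b))"

text \<open>Agreement at \<open>l\<close> includes equality of the restricted groupoid elements, and
  these alone govern the continuation along \<open>m\<close>. The length bounds make
  \<open>drop\<close> cut within \<open>l\<close>, so that all of \<open>m\<close> survives.\<close>

lemma expand_append:
  assumes "domain_length t \<le> length l" "domain_length u \<le> length l" "expand t l = expand u l"
  shows "expand t (l @ m) = expand u (l @ m)"
  using assms
  by (auto simp: expand_def Let_def act_list_append res_list_append simp flip: append_assoc
      split: prod.splits)

lemma germ_reps_iff:
  "(((v, a), g, (w, b)), \<xi>) \<in> germ_reps \<longleftrightarrow>
    is_path v a \<and> is_path w b \<and> g \<in> arrows G \<and> grng G g = psrc (v, a) \<and> gsrc G g = psrc (w, b) \<and>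
    \<xi> \<in> bpaths \<and> brng \<xi> = w \<and> bprefix b \<xi>"
  by (auto simp: germ_reps_def triples_def mem_cyl_iff)

text \<open>In \<open>germ_rel\<close> the extensions \<beta>' and \<delta>' are what remains of the
  common path \<beta>\<beta>' = \<delta>\<delta>' after its two initial parts, so the edge list
  \<open>l\<close> of that path is a sufficient witness.\<close>

lemma germ_rel_iff:
  "((t, \<xi>), (u, \<eta>)) \<in> germ_rel \<longleftrightarrow> (t, \<xi>) \<in> germ_reps \<and> (u, \<eta>) \<in> germ_reps \<and> \<xi> = \<eta> \<and>
    (\<exists>l. bprefix l \<xi> \<and> domain_length t \<le> length l \<and> domain_length u \<le> length l \<and>
      expand t l = expand u l)"
proof (cases "(t, \<xi>) \<in> germ_reps \<and> (u, \<eta>) \<in> germ_reps \<and> \<xi> = \<eta>")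
  case True
  obtain v a g w b where t: "t = ((v, a), g, (w, b))" by (metis surj_pair)
  obtain v' a' h w' d where u: "u = ((v', a'), h, (w', d))" by (metis surj_pair)
  have T: "(((v, a), g, (w, b)), \<xi>) \<in> germ_reps" "(((v', a'), h, (w', d)), \<xi>) \<in> germ_reps"
    using True t u by auto
  then have w: "w' = w" and p: "\<xi> \<in> bpaths" "brng \<xi> = w" "bprefix b \<xi>" "bprefix d \<xi>"
    unfolding germ_reps_iff by auto
  show ?thesis
  proof
    assume "((t, \<xi>), (u, \<eta>)) \<in> germ_rel"
    then obtain b' d' where *: "(psrc (w, b), b') \<in> fpaths" "b @ b' = d @ d'"
      "\<xi> \<in> cyl (w, b @ b')" "v = v'" "a @ act_list g b' = a' @ act_list h d'"
      "res_list g b' = res_list h d'"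
      unfolding t u germ_rel_def by (auto simp: pcat_def pact_def pres_def)
    have "bprefix (b @ b') \<xi>"
      using *(1,3) T(1) by (auto simp: germ_reps_iff mem_cyl_iff)
    moreover have "expand t (b @ b') = expand u (b @ b')"
    proof -
      have "expand t (b @ b') = (v, a @ act_list g b', res_list g b')"
        by (simp add: expand_def t plen_def)
      moreover have "expand u (d @ d') = (v', a' @ act_list h d', res_list h d')"
        by (simp add: expand_def u plen_def)
      ultimately show ?thesis using * by simp
    qed
    moreover have "domain_length t \<le> length (b @ b')" "domain_length u \<le> length (b @ b')"
      by (simp add: t plen_def) (simp add: u plen_def *(2))
    ultimately show "(t, \<xi>) \<in> germ_reps \<and> (u, \<eta>) \<in> germ_reps \<and> \<xi> = \<eta> \<and>
    (\<exists>l. bprefix l \<xi> \<and> domain_length t \<le> length l \<and> domain_length u \<le> length l \<and>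
      expand t l = expand u l)"
      using True by blast
  next
    assume "(t, \<xi>) \<in> germ_reps \<and> (u, \<eta>) \<in> germ_reps \<and> \<xi> = \<eta> \<and>
    (\<exists>l. bprefix l \<xi> \<and> domain_length t \<le> length l \<and> domain_length u \<le> length l \<and>
      expand t l = expand u l)"
    then obtain l where l: "bprefix l \<xi>" "length b \<le> length l" "length d \<le> length l"
      "expand t l = expand u l"
      unfolding t u by (auto simp: plen_def)
    then obtain b' d' where bd: "l = b @ b'" "l = d @ d'"
      using bprefix_linear p by (metis prefix_def)
    have "is_path w l" using bpath_is_path l p by blast
    then have "is_path w (b @ b')" "is_path w (d @ d')" using bd by metis+
    then have paths: "(psrc (w, b), b') \<in> fpaths" "(psrc (w, d), d') \<in> fpaths" "is_path w (b @ b')"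
      by auto
    have cyl: "\<xi> \<in> cyl (w, b @ b')"
      unfolding mem_cyl_iff[OF paths(3)] using p l bd by simp
    have exp_t: "expand t l = (v, a @ act_list g b', res_list g b')"
      by (simp add: expand_def t plen_def bd(1))
    have exp_u: "expand u l = (v', a' @ act_list h d', res_list h d')"
      by (simp add: expand_def u plen_def bd(2))
    have "\<exists>\<beta>'\<in>fpaths. \<exists>\<delta>'\<in>fpaths. prng \<beta>' = psrc (w, b) \<and> prng \<delta>' = psrc (w, d) \<and>
        pcat (w, b) \<beta>' = pcat (w, d) \<delta>' \<and> \<xi> \<in> cyl (pcat (w, b) \<beta>') \<and>
        pcat (v, a) (pact g \<beta>') = pcat (v', a') (pact h \<delta>') \<and> pres g \<beta>' = pres h \<delta>'"
      by (rule bexI[of _ "(psrc (w, b), b')"], rule bexI[of _ "(psrc (w, d), d')"])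
        (use paths cyl exp_t exp_u l(4) bd in \<open>simp_all add: pcat_def pact_def pres_def\<close>)
    then have "((((v, a), g, (w, b)), \<xi>), (((v', a'), h, (w, d)), \<xi>)) \<in> germ_rel"
      unfolding germ_rel_def using T w by simp
    then show "((t, \<xi>), (u, \<eta>)) \<in> germ_rel" using True t u w by simp
  qed
qed (cases t; cases u; auto simp: germ_rel_def)

lemma equiv_germ_rel: "equiv germ_reps germ_rel"
proof (rule equivI)
  show "germ_rel \<subseteq> germ_reps \<times> germ_reps"
    by (auto simp only: germ_rel_iff split_paired_all)
  show "refl_on germ_reps germ_rel"
  proof (rule refl_onI)
    fix x assume "x \<in> germ_reps"
    moreover obtain v a g w b \<xi> where "x = (((v, a), g, (w, b)), \<xi>)" by (metis surj_pair)
    ultimately show "(x, x) \<in> germ_rel"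
      by (auto simp: germ_rel_iff germ_reps_iff plen_def)
  qed
  show "sym germ_rel"
  proof (rule symI)
    fix x y assume "(x, y) \<in> germ_rel"
    moreover obtain t u \<xi> \<eta> where "x = (t, \<xi>)" "y = (u, \<eta>)" by (metis surj_pair)
    ultimately show "(y, x) \<in> germ_rel" unfolding germ_rel_iff by (metis germ_rel_iff)
  qed
  show "trans germ_rel"
  proof (rule transI)
    fix x y z assume xy: "(x, y) \<in> germ_rel" and yz: "(y, z) \<in> germ_rel"
    obtain t u s \<xi> \<eta> \<zeta> where e: "x = (t, \<xi>)" "y = (u, \<eta>)" "z = (s, \<zeta>)" by (metis surj_pair)
    obtain l where l: "bprefix l \<xi>" "domain_length t \<le> length l" "domain_length u \<le> length l"
      "expand t l = expand u l" "\<eta> = \<xi>" "(t, \<xi>) \<in> germ_reps"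
      using xy unfolding e germ_rel_iff by blast
    obtain m where m: "bprefix m \<xi>" "domain_length u \<le> length m" "domain_length s \<le> length m"
      "expand u m = expand s m" "\<zeta> = \<xi>" "(s, \<xi>) \<in> germ_reps"
      using yz l(5) unfolding e germ_rel_iff by blast
    \<comment> \<open>Both witnesses are prefixes of the same path; the longer one serves for both
      relations by \<open>expand_append\<close>.\<close>
    consider n where "l @ n = m" | n where "m @ n = l"
      using bprefix_linear[OF l(1) m(1)] bprefix_linear[OF m(1) l(1)]
      by (metis linorder_linear prefix_def)
    then show "(x, z) \<in> germ_rel"
    proof cases
      case 1
      then have "expand t m = expand s m"
        using expand_append[of t l u n] l m by auto
      then show ?thesis unfolding e germ_rel_iff using l m 1 by (auto intro!: exI[of _ m])
    next
      case 2
      then have "expand t l = expand s l"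
        using expand_append[of u m s n] l m by auto
      then show ?thesis unfolding e germ_rel_iff using l m 2 by (auto intro!: exI[of _ l])
    qed
  qed
qed

lemma germ_eq_iff:
  assumes "(t, \<xi>) \<in> germ_reps" "(u, \<eta>) \<in> germ_reps"
  shows "germ t \<xi> = germ u \<eta> \<longleftrightarrow> \<xi> = \<eta> \<and>
    (\<exists>l. bprefix l \<xi> \<and> domain_length t \<le> length l \<and> domain_length u \<le> length l \<and>
      expand t l = expand u l)"
  unfolding germ_def using eq_equiv_class_iff[OF equiv_germ_rel assms] assms germ_rel_iff by simp

lemma mem_germ: "(u, \<eta>) \<in> germ t \<xi> \<longleftrightarrow> ((t, \<xi>), (u, \<eta>)) \<in> germ_rel"
  by (simp add: germ_def)

lemma germ_in_germs: "(t, \<xi>) \<in> germ_reps \<Longrightarrow> germ t \<xi> \<in> germs"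
  by (simp add: germ_def germs_def quotientI)

lemma germs_cases:
  assumes "X \<in> germs"
  obtains t \<xi> where "(t, \<xi>) \<in> germ_reps" "X = germ t \<xi>"
  using assms unfolding germs_def germ_def by (auto elim: quotientE)

text \<open>Prepares the comparison of two germs at the same path: both can be rewritten with the
  same third component \<open>(brng \<xi>, l)\<close>.\<close>

lemma germ_expand:
  assumes "(t, \<xi>) \<in> germ_reps" "bprefix l \<xi>" "domain_length t \<le> length l"
  shows "\<exists>v a g. (((v, a), g, (brng \<xi>, l)), \<xi>) \<in> germ_reps \<and>
    germ t \<xi> = germ ((v, a), g, (brng \<xi>, l)) \<xi>"
proof -
  obtain v a g w b where t: "t = ((v, a), g, (w, b))" by (metis surj_pair)
  note r = assms(1)[unfolded t germ_reps_iff]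
  obtain b' where b': "l = b @ b'"
    using bprefix_linear[of b \<xi> l] r assms by (auto simp: t plen_def prefix_def)
  have "is_path w l" using bpath_is_path assms r by blast
  then have "is_path (gsrc G g) b'" using b' r by auto
  then have "(((v, a @ act_list g b'), res_list g b', (brng \<xi>, l)), \<xi>) \<in> germ_reps"
    using r action_on_path[of g b'] b' assms(2) \<open>is_path w l\<close> by (auto simp: germ_reps_iff)
  moreover have "expand t l = expand ((v, a @ act_list g b'), res_list g b', (brng \<xi>, l)) l"
    by (simp add: expand_def t plen_def b')
  ultimately show ?thesis
    using germ_eq_iff[OF assms(1)] assms by (metis order.refl plen_def snd_conv)
qed

text \<open>Since the outer components coincide, the two expansions along \<open>l @ m\<close>
  differ at most in how \<open>g\<close> and \<open>h\<close> act on \<open>m\<close>, so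
  \<open>agree_iff_strongly_fixed\<close> decides equality.\<close>

lemma same_ends_germ_eq_iff:
  assumes "(((v, a), g, (w, l)), \<xi>) \<in> germ_reps" "(((v, a), h, (w, l)), \<xi>) \<in> germ_reps"
  shows "germ ((v, a), g, (w, l)) \<xi> = germ ((v, a), h, (w, l)) \<xi> \<longleftrightarrow>
    (\<exists>m. bprefix (l @ m) \<xi> \<and> strongly_fixed (gmult G (ginv G h) g) (psrc (w, l), m))"
proof -
  note r = assms[unfolded germ_reps_iff]
  have agree: "expand ((v, a), g, (w, l)) (l @ m) = expand ((v, a), h, (w, l)) (l @ m) \<longleftrightarrow>
      strongly_fixed (gmult G (ginv G h) g) (psrc (w, l), m)" if "bprefix (l @ m) \<xi>" for m
  proof -
    have "is_path (brng \<xi>) (l @ m)" using bpath_is_path r that by blast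
    then have "is_path (gsrc G g) m" using r by simp
    then have "act_list g m = act_list h m \<and> res_list g m = res_list h m \<longleftrightarrow>
      strongly_fixed (gmult G (ginv G h) g) (gsrc G g, m)"
      using r by (intro agree_iff_strongly_fixed) auto
    then show ?thesis using r by (auto simp: expand_def plen_def)
  qed
  have ext: "\<exists>m. n = l @ m" if "bprefix n \<xi>" "length l \<le> length n" for n
    using bprefix_linear[of l \<xi> n] that r by (auto simp: prefix_def)
  have "germ ((v, a), g, (w, l)) \<xi> = germ ((v, a), h, (w, l)) \<xi> \<longleftrightarrow>
    (\<exists>n. bprefix n \<xi> \<and> length l \<le> length n \<and>
      expand ((v, a), g, (w, l)) n = expand ((v, a), h, (w, l)) n)"
    using germ_eq_iff[OF assms] by (simp add: plen_def)
  also have "\<dots> \<longleftrightarrow> (\<exists>m. bprefix (l @ m) \<xi> \<and>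
      expand ((v, a), g, (w, l)) (l @ m) = expand ((v, a), h, (w, l)) (l @ m))"
    using ext by (metis le_add1 length_append)
  finally show ?thesis using agree by auto
qed

section \<open>Topology on the germs\<close>

lemma openin_germ_image:
  assumes "(\<alpha>, g, \<beta>) \<in> triples" "V \<subseteq> cyl \<beta>" "openin path_topology V"
  shows "openin germ_topology (germ (\<alpha>, g, \<beta>) ` V)"
  unfolding germ_topology_def by (rule topology_generated_by_Basis) (use assms in blast)

text \<open>An equality of germs at \<xi> is witnessed by a finite prefix \<open>l\<close>, and the
  same witness works at nearby paths in the cylinder of \<open>l\<close>. Continuity serves to pull
  separating open sets of germs back to the path space.\<close>

lemma continuous_map_germ:
  assumes t: "(\<alpha>, g, \<beta>) \<in> triples"
  shows "continuous_map (subtopology path_topology (cyl \<beta>)) germ_topology (germ (\<alpha>, g, \<beta>))"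
proof -
  define t where "t = (\<alpha>, g, \<beta>)"
  have cyl: "openin path_topology (cyl \<beta>)" using assms by (auto simp: triples_def openin_cyl)
  then have ts: "topspace (subtopology path_topology (cyl \<beta>)) = cyl \<beta>"
    using openin_subset by fastforce
  have "openin path_topology (germ t -` (germ u ` V) \<inter> cyl \<beta>)"
    if u: "u = (\<gamma>, h, \<delta>)" "u \<in> triples" "V \<subseteq> cyl \<delta>" "openin path_topology V" for u \<gamma> h \<delta> V
  proof (subst openin_subopen, intro ballI)
    fix \<xi> assume \<xi>: "\<xi> \<in> germ t -` (germ u ` V) \<inter> cyl \<beta>"
    have t_rep: "(t, \<zeta>) \<in> germ_reps" if "\<zeta> \<in> cyl \<beta>" for \<zeta>
      using that t by (simp add: t_def germ_reps_def)
    have u_rep: "(u, \<zeta>) \<in> germ_reps" if "\<zeta> \<in> V" for \<zeta>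
      using that u by (auto simp: germ_reps_def)
    obtain \<eta> where \<eta>: "\<eta> \<in> V" "germ t \<xi> = germ u \<eta>" using \<xi> by auto
    then obtain l where l: "bprefix l \<xi>" "domain_length t \<le> length l" "domain_length u \<le> length l"
      "expand t l = expand u l" and eq: "\<eta> = \<xi>"
      using germ_eq_iff t_rep u_rep \<xi> by (metis IntD2)
    define w where "w = brng \<xi>"
    have "\<xi> \<in> bpaths" using t_rep \<xi> by (metis IntD2 germ_reps_iff surj_pair)
    then have path: "is_path w l" using l(1) bpath_is_path w_def by blast
    have "openin path_topology (cyl (w, l) \<inter> V \<inter> cyl \<beta>)"
      using path u(4) cyl by (intro openin_Int) (auto intro: openin_cyl)
    moreover have "\<xi> \<in> cyl (w, l) \<inter> V \<inter> cyl \<beta>"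
      using \<xi> \<eta> eq l(1) \<open>\<xi> \<in> bpaths\<close> w_def[symmetric] by (simp add: mem_cyl_iff[OF path])
    moreover have "cyl (w, l) \<inter> V \<inter> cyl \<beta> \<subseteq> germ t -` (germ u ` V) \<inter> cyl \<beta>"
    proof
      fix \<zeta> assume \<zeta>: "\<zeta> \<in> cyl (w, l) \<inter> V \<inter> cyl \<beta>"
      then have "germ t \<zeta> = germ u \<zeta>"
        using germ_eq_iff[OF t_rep u_rep, of \<zeta> \<zeta>] l(2-4) by (auto simp: mem_cyl_iff[OF path])
      then show "\<zeta> \<in> germ t -` (germ u ` V) \<inter> cyl \<beta>" using \<zeta> by auto
    qed
    ultimately show "\<exists>T. openin path_topology T \<and> \<xi> \<in> T \<and> T \<subseteq> germ t -` (germ u ` V) \<inter> cyl \<beta>"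
      by blast
  qed
  then show ?thesis
    unfolding germ_topology_def ts t_def[symmetric]
  proof (intro continuous_on_generated_topo)
    fix U assume *: "\<And>u \<gamma> h \<delta> V. u = (\<gamma>, h, \<delta>) \<Longrightarrow> u \<in> triples \<Longrightarrow> V \<subseteq> cyl \<delta> \<Longrightarrow>
      openin path_topology V \<Longrightarrow> openin path_topology (germ t -` (germ u ` V) \<inter> cyl \<beta>)"
      and "U \<in> {germ (\<alpha>, g, \<beta>) ` V |\<alpha> g \<beta> V.
        (\<alpha>, g, \<beta>) \<in> triples \<and> V \<subseteq> cyl \<beta> \<and> openin path_topology V}"
    then have "openin path_topology (germ t -` U \<inter> cyl \<beta>)" by blast
    then show "openin (subtopology path_topology (cyl \<beta>))
       (germ t -` U \<inter> topspace (subtopology path_topology (cyl \<beta>)))"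
      unfolding ts openin_subtopology by blast
  next
    show "germ t ` topspace (subtopology path_topology (cyl \<beta>)) \<subseteq>
      \<Union> {germ (\<alpha>, g, \<beta>) ` V |\<alpha> g \<beta> V.
        (\<alpha>, g, \<beta>) \<in> triples \<and> V \<subseteq> cyl \<beta> \<and> openin path_topology V}"
      unfolding ts using t cyl t_def by blast
  qed
qed

section \<open>Separation of germs under (Fin)\<close>

lemma separate_germs_same_source:
  assumes fin: cond_Fin
    and t: "(t, \<xi>) \<in> germ_reps" and u: "(u, \<xi>) \<in> germ_reps" and ne: "germ t \<xi> \<noteq> germ u \<xi>"
  shows "\<exists>U V. openin germ_topology U \<and> openin germ_topology V \<and> germ t \<xi> \<in> U \<and> germ u \<xi> \<in> V \<and>
    U \<inter> V = {}"
proof -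
  define w where "w = brng \<xi>"
  \<comment> \<open>The longer of the two third components, to which both germs can be
    expanded.\<close>
  define l where "l = (if domain_length u \<le> domain_length t then snd (snd (snd t)) else snd (snd (snd u)))"
  have l: "bprefix l \<xi>" "domain_length t \<le> length l" "domain_length u \<le> length l"
    using t u unfolding l_def plen_def by (cases t; cases u; auto simp: germ_reps_iff)+
  have \<xi>: "\<xi> \<in> bpaths" using t by (metis germ_reps_iff surj_pair)
  obtain v a g where g: "(((v, a), g, (w, l)), \<xi>) \<in> germ_reps"
    "germ t \<xi> = germ ((v, a), g, (w, l)) \<xi>"
    using germ_expand[OF t l(1,2)] w_def by blast
  obtain v' a' h where h: "(((v', a'), h, (w, l)), \<xi>) \<in> germ_reps"
    "germ u \<xi> = germ ((v', a'), h, (w, l)) \<xi>"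
    using germ_expand[OF u l(1,3)] w_def by blast
  note rg = g(1)[unfolded germ_reps_iff] and rh = h(1)[unfolded germ_reps_iff]
  have path: "is_path w l" using rg by blast
  have tr: "((v, a), g, (w, l)) \<in> triples" "((v', a'), h, (w, l)) \<in> triples"
    using g(1) h(1) by (auto simp: germ_reps_def)
  have reps: "(((v, a), g, (w, l)), \<zeta>) \<in> germ_reps" "(((v', a'), h, (w, l)), \<zeta>) \<in> germ_reps"
    if "\<zeta> \<in> cyl (w, l)" for \<zeta>
    using tr that by (auto simp: germ_reps_def)
  obtain V where V: "V \<subseteq> cyl (w, l)" "openin path_topology V" "\<xi> \<in> V"
    and disj: "\<And>\<zeta>. \<zeta> \<in> V \<Longrightarrow> germ ((v, a), g, (w, l)) \<zeta> \<noteq> germ ((v', a'), h, (w, l)) \<zeta>"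
  proof (cases "(v, a) = (v', a')")
    case False
    \<comment> \<open>Over the common third component both expansions append lists of equal length
      to \<open>a\<close> and \<open>a'\<close>, so distinct pairs \<open>(v, a)\<close> and
      \<open>(v', a')\<close> never become equal.\<close>
    have "germ ((v, a), g, (w, l)) \<zeta> \<noteq> germ ((v', a'), h, (w, l)) \<zeta>" if "\<zeta> \<in> cyl (w, l)" for \<zeta>
      using False by (auto simp: germ_eq_iff[OF reps[OF that]] expand_def Let_def)
    moreover have "\<xi> \<in> cyl (w, l)" using rg by (simp add: mem_cyl_iff)
    ultimately show ?thesis
      using that[of "cyl (w, l)"] path openin_cyl by auto
  next
    case True
    define k where "k = gmult G (ginv G h) g"
    define F where "F = {\<mu>. minimal_strongly_fixed k \<mu>}"
    have k: "k \<in> arrows G" "gsrc G k = psrc (w, l)"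
      unfolding k_def using rg rh True
      by (auto simp: gmult_closed ginv_closed gsrc_ginv gsrc_gmult)
    have F: "finite F" "F \<subseteq> {\<beta> \<in> fpaths. prng \<beta> = psrc (w, l)}"
      using fin k by (auto simp: F_def cond_Fin_def minimal_strongly_fixed_def strongly_fixed_def)
    \<comment> \<open>The set on which the two germs differ; it is open because \<open>F\<close> is
      finite, which is where (Fin) enters.\<close>
    define V where "V = cyl (w, l) - (\<Union>\<beta>\<in>F. cyl (pcat (w, l) \<beta>))"
    have mem_V: "\<zeta> \<in> V \<longleftrightarrow> germ ((v, a), g, (w, l)) \<zeta> \<noteq> germ ((v, a), h, (w, l)) \<zeta>"
      if \<zeta>: "\<zeta> \<in> cyl (w, l)" for \<zeta>
    proof -
      have z: "\<zeta> \<in> bpaths" "brng \<zeta> = w" using \<zeta> path by (auto simp: mem_cyl_iff)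
      have "\<zeta> \<in> V \<longleftrightarrow> \<not> (\<exists>m. (psrc (w, l), m) \<in> F \<and> \<zeta> \<in> cyl (w, l @ m))"
        using \<zeta> F(2) unfolding V_def by (force simp: pcat_def)
      also have "\<dots> \<longleftrightarrow> \<not> (\<exists>m. minimal_strongly_fixed k (psrc (w, l), m) \<and> bprefix (l @ m) \<zeta>)"
        using path z by (auto simp: F_def mem_cyl_iff minimal_strongly_fixed_def strongly_fixed_iff)
      \<comment> \<open>Every strongly fixed path has a minimal one as a prefix, so removing the
        cylinders of the minimal ones removes the cylinders of all.\<close>
      also have "\<dots> \<longleftrightarrow> \<not> (\<exists>m. strongly_fixed k (psrc (w, l), m) \<and> bprefix (l @ m) \<zeta>)"
      proof -
        have "\<exists>m. minimal_strongly_fixed k (psrc (w, l), m) \<and> bprefix (l @ m) \<zeta>"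
          if m: "strongly_fixed k (psrc (w, l), m)" "bprefix (l @ m) \<zeta>" for m
        proof -
          obtain n where "prefix n m" "minimal_strongly_fixed k (psrc (w, l), n)"
            using strongly_fixed_minimal_prefix[OF m(1)] by blast
          moreover from this have "prefix (l @ n) (l @ m)" by simp
          ultimately show ?thesis using bprefix_prefix m(2) by blast
        qed
        then show ?thesis unfolding minimal_strongly_fixed_def by blast
      qed
      also have "\<dots> \<longleftrightarrow> germ ((v, a), g, (w, l)) \<zeta> \<noteq> germ ((v, a), h, (w, l)) \<zeta>"
        using same_ends_germ_eq_iff[of v a g w l \<zeta> h] reps[OF \<zeta>] True k_def by auto
      finally show ?thesis .
    qed
    have "openin path_topology V"
      unfolding V_def using path F by (intro openin_cyl_diff) auto
    moreover have "\<xi> \<in> V" using mem_V[of \<xi>] rg ne g h True by (simp add: mem_cyl_iff)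
    moreover have "V \<subseteq> cyl (w, l)" unfolding V_def by blast
    ultimately show ?thesis using that[of V] mem_V True by blast
  qed
  have "germ ((v, a), g, (w, l)) ` V \<inter> germ ((v', a'), h, (w, l)) ` V = {}"
    using disj germ_eq_iff reps V(1) by (smt (verit) disjoint_iff imageE subsetD)
  then show ?thesis
    using openin_germ_image[OF tr(1) V(1,2)] openin_germ_image[OF tr(2) V(1,2)] V(3) g(2) h(2)
    by blast
qed

text \<open>Germs with different sources are never equal, so disjoint neighbourhoods of the sources
  in the path space yield disjoint sets of germs. (Fin) enters for germs with a common
  source.\<close>

lemma separate_germs:
  assumes fin: cond_Fin and X: "X \<in> germs" and Y: "Y \<in> germs" and ne: "X \<noteq> Y"
  shows "\<exists>U V. openin germ_topology U \<and> openin germ_topology V \<and> X \<in> U \<and> Y \<in> V \<and> U \<inter> V = {}"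
proof -
  obtain t \<xi> where t: "(t, \<xi>) \<in> germ_reps" "X = germ t \<xi>" using X by (rule germs_cases)
  obtain u \<eta> where u: "(u, \<eta>) \<in> germ_reps" "Y = germ u \<eta>" using Y by (rule germs_cases)
  show ?thesis
  proof (cases "\<xi> = \<eta>")
    case True
    then show ?thesis using separate_germs_same_source fin t u ne by blast
  next
    case False
    obtain \<alpha> g \<beta> where te: "t = (\<alpha>, g, \<beta>)" by (metis surj_pair)
    obtain \<gamma> h \<delta> where ue: "u = (\<gamma>, h, \<delta>)" by (metis surj_pair)
    have tr: "(\<alpha>, g, \<beta>) \<in> triples" "(\<gamma>, h, \<delta>) \<in> triples" "\<xi> \<in> cyl \<beta>" "\<eta> \<in> cyl \<delta>"
      using t u te ue by (auto simp: germ_reps_def)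
    have "\<xi> \<in> bpaths" "\<eta> \<in> bpaths"
      using t(1) u(1) by (metis germ_reps_iff surj_pair)+
    then obtain U V where UV: "openin path_topology U" "openin path_topology V" "\<xi> \<in> U" "\<eta> \<in> V"
      "U \<inter> V = {}"
      using path_space_Hausdorff False by metis
    have cyl: "openin path_topology (cyl \<beta>)" "openin path_topology (cyl \<delta>)"
      using tr by (auto simp: triples_def openin_cyl)
    have "openin germ_topology (germ t ` (U \<inter> cyl \<beta>))" "openin germ_topology (germ u ` (V \<inter> cyl \<delta>))"
      unfolding te ue by (rule openin_germ_image; use tr cyl UV in auto)+
    moreover have "germ t ` (U \<inter> cyl \<beta>) \<inter> germ u ` (V \<inter> cyl \<delta>) = {}"
    proof -
      have "germ t \<zeta> \<noteq> germ u \<zeta>'" if "\<zeta> \<in> U \<inter> cyl \<beta>" "\<zeta>' \<in> V \<inter> cyl \<delta>" for \<zeta> \<zeta>'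
      proof -
        have "(t, \<zeta>) \<in> germ_reps" "(u, \<zeta>') \<in> germ_reps"
          using that tr te ue by (auto simp: germ_reps_def)
        then show ?thesis using germ_eq_iff that UV(5) by blast
      qed
      then show ?thesis by blast
    qed
    ultimately show ?thesis
      using tr UV t(2) u(2) by blast
  qed
qed

lemma cond_Fin_imp_Hausdorff:
  assumes cond_Fin
  shows "hausdorff_germs tG"
  unfolding hausdorff_germs_def Hausdorff_space_def
proof (intro allI impI)
  fix X Y
  assume "X \<in> topspace (subtopology germ_topology (arrows tG)) \<and>
    Y \<in> topspace (subtopology germ_topology (arrows tG)) \<and> X \<noteq> Y"
  then have XY: "X \<in> germs" "Y \<in> germs" "X \<noteq> Y" by (auto simp: tG_def)
  then obtain U V where "openin germ_topology U" "openin germ_topology V" "X \<in> U" "Y \<in> V" "U \<inter> V = {}"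
    using separate_germs assms by meson
  then show "\<exists>U V. openin (subtopology germ_topology (arrows tG)) U \<and>
    openin (subtopology germ_topology (arrows tG)) V \<and> X \<in> U \<and> Y \<in> V \<and> disjnt U V"
    using XY by (intro exI[of _ "U \<inter> germs"] exI[of _ "V \<inter> germs"])
      (auto simp: openin_subtopology tG_def disjnt_def)
qed

section \<open>Germs over the boundary\<close>

lemma bcat_bcat: "bcat \<alpha> (bcat \<beta> \<theta>) = bcat (pcat \<alpha> \<beta>) \<theta>"
proof (cases \<theta>)
  case (InfP x)
  have "(if n < plen \<alpha> then snd \<alpha> ! n
      else if n - plen \<alpha> < plen \<beta> then snd \<beta> ! (n - plen \<alpha>) else x (n - plen \<alpha> - plen \<beta>)) =
    (if n < plen (pcat \<alpha> \<beta>) then snd (pcat \<alpha> \<beta>) ! n else x (n - plen (pcat \<alpha> \<beta>)))" for n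
    by (auto simp: plen_def pcat_def nth_append)
  then show ?thesis unfolding InfP bcat.simps by presburger
qed (simp add: pcat_def)

lemma nth_act_list: "n < length b \<Longrightarrow> act_list g b ! n = act (res_list g (take n b)) (b ! n)"
  by (induction b arbitrary: g n) (auto simp: nth_Cons split: nat.split)

text \<open>An edge of the image depends on the restriction of \<open>g\<close> along the edges
  before it; beyond the end of \<open>b\<close> this restriction factors through
  \<open>res_list g b\<close>.\<close>

lemma bact_bcat: "bact g (bcat (c, b) \<theta>) = bcat (grng G g, act_list g b) (bact (res_list g b) \<theta>)"
proof (cases \<theta>)
  case (InfP x)
  define y where "y n = (if n < length b then b ! n else x (n - length b))" for n
  have y: "map y [0..<n] = (if n < length b then take n b else b @ map x [0..<n - length b])" for n
    by (rule nth_equalityI) (auto simp: y_def nth_append)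
  have "act (res_list g (map y [0..<n])) (y n) =
    (if n < length b then act_list g b ! n
     else act (res_list (res_list g b) (map x [0..<n - length b])) (x (n - length b)))" for n
    unfolding y by (auto simp: y_def nth_act_list res_list_append)
  then show ?thesis
    unfolding InfP bcat.simps bact.simps plen_def snd_conv length_act_list y_def[symmetric, abs_def]
    by simp
qed (simp add: pcat_def pact_def act_list_append)

text \<open>If \<zeta> = b'\<theta>, then \<open>bact_bcat\<close> splits the image of \<zeta> into
  the image of b' followed by that of \<theta> under the restriction. Passing to a longer
  representative therefore leaves the range unchanged.\<close>

lemma range_expand:
  assumes "((\<alpha>, g, \<beta>), bcat \<beta> \<zeta>) \<in> germ_reps" "brng \<zeta> = psrc \<beta>"
    and "bcat \<beta> \<zeta> = bcat (fst \<beta>, l) \<theta>" "brng \<theta> = psrc (fst \<beta>, l)" "is_path (fst \<beta>) l" "\<theta> \<in> bpaths"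
    and "plen \<beta> \<le> length l" "expand (\<alpha>, g, \<beta>) l = (v, a, k)"
  shows "bcat \<alpha> (bact g \<zeta>) = bcat (v, a) (bact k \<theta>)"
proof -
  obtain w b where \<beta>: "\<beta> = (w, b)" by (metis surj_pair)
  have "bprefix b (bcat \<beta> \<zeta>)" unfolding \<beta> by (rule bprefix_bcat)
  moreover have "bprefix l (bcat \<beta> \<zeta>)" unfolding assms(3) by (rule bprefix_bcat)
  ultimately obtain b' where l: "l = b @ b'"
    using bprefix_linear[of b "bcat \<beta> \<zeta>" l] assms(7) by (auto simp: \<beta> plen_def prefix_def)
  have p: "is_path (psrc \<beta>) b'" "brng \<theta> = psrc (psrc \<beta>, b')" using assms(4,5) l \<beta> by auto
  have "bcat \<beta> \<zeta> = bcat \<beta> (bcat (psrc \<beta>, b') \<theta>)"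
    unfolding bcat_bcat using assms(3) by (simp add: \<beta> l pcat_def)
  then have "\<zeta> = bcat (psrc \<beta>, b') \<theta>"
    by (rule bcat_inject) (use assms(2) bcat_bpath[OF p(1) assms(6) p(2)] in simp)
  then have "bcat \<alpha> (bact g \<zeta>) = bcat (pcat \<alpha> (grng G g, act_list g b')) (bact (res_list g b') \<theta>)"
    by (simp add: bact_bcat bcat_bcat)
  moreover have "pcat \<alpha> (grng G g, act_list g b') = (v, a)" "k = res_list g b'"
    using assms(8) by (auto simp: expand_def pcat_def \<beta> plen_def l Let_def)
  ultimately show ?thesis by simp
qed

text \<open>Needed for the definite description in \<open>germ_range\<close>: related
  representatives have a common expansion, from which both ranges can be computed.\<close>

lemma range_well_defined:
  assumes rel: "(((\<alpha>, g, \<beta>), bcat \<beta> \<zeta>), ((\<gamma>, h, \<delta>), bcat \<delta> \<zeta>')) \<in> germ_rel"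
    and \<zeta>: "brng \<zeta> = psrc \<beta>" "brng \<zeta>' = psrc \<delta>"
  shows "bcat \<alpha> (bact g \<zeta>) = bcat \<gamma> (bact h \<zeta>')"
proof -
  define \<xi> where "\<xi> = bcat \<beta> \<zeta>"
  have \<xi>: "\<xi> = bcat \<delta> \<zeta>'" "((\<alpha>, g, \<beta>), \<xi>) \<in> germ_reps" "((\<gamma>, h, \<delta>), \<xi>) \<in> germ_reps"
    using rel by (auto simp: germ_rel_iff \<xi>_def)
  obtain l where l: "bprefix l \<xi>" "plen \<beta> \<le> length l" "plen \<delta> \<le> length l"
    "expand (\<alpha>, g, \<beta>) l = expand (\<gamma>, h, \<delta>) l"
    using rel by (auto simp: germ_rel_iff \<xi>_def)
  have b: "\<xi> \<in> bpaths" "brng \<xi> = fst \<beta>" "brng \<xi> = fst \<delta>"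
    using \<xi>(2,3) by (cases \<alpha>; cases \<beta>; cases \<gamma>; cases \<delta>; auto simp: germ_reps_iff)+
  obtain \<theta> where \<theta>: "\<theta> \<in> bpaths" "brng \<theta> = psrc (brng \<xi>, l)" "\<xi> = bcat (brng \<xi>, l) \<theta>"
    using bcat_surj b(1) l(1) by blast
  have p: "is_path (brng \<xi>) l" using bpath_is_path b l by blast
  obtain v a k where e: "expand (\<alpha>, g, \<beta>) l = (v, a, k)" by (metis surj_pair)
  have "bcat \<alpha> (bact g \<zeta>) = bcat (v, a) (bact k \<theta>)"
    using range_expand[of \<alpha> g \<beta> \<zeta> l \<theta>] \<xi>(2) \<zeta>(1) \<theta> p l(2) e b(2) \<xi>_def by metis
  moreover have "bcat \<gamma> (bact h \<zeta>') = bcat (v, a) (bact k \<theta>)"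
    using range_expand[of \<gamma> h \<delta> \<zeta>' l \<theta>] \<xi>(1,3) \<zeta>(2) \<theta> p l(3,4) e b(3) by metis
  ultimately show ?thesis by simp
qed

lemma germ_source_germ:
  assumes "(t, \<xi>) \<in> germ_reps"
  shows "germ_source (germ t \<xi>) = \<xi>"
  unfolding germ_source_def
proof (rule the_equality)
  have "(t, \<xi>) \<in> germ t \<xi>"
    using assms equiv_germ_rel by (simp add: mem_germ equiv_class_eq_iff)
  then show "\<exists>u. (u, \<xi>) \<in> germ t \<xi>" by blast
qed (auto simp: mem_germ germ_rel_iff)

lemma germ_range_germ:
  assumes "((\<alpha>, g, \<beta>), bcat \<beta> \<zeta>) \<in> germ_reps" "\<zeta> \<in> bpaths" "brng \<zeta> = psrc \<beta>"
  shows "germ_range (germ (\<alpha>, g, \<beta>) (bcat \<beta> \<zeta>)) = bcat \<alpha> (bact g \<zeta>)"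
  unfolding germ_range_def
proof (rule the_equality)
  have "((\<alpha>, g, \<beta>), bcat \<beta> \<zeta>) \<in> germ (\<alpha>, g, \<beta>) (bcat \<beta> \<zeta>)"
    using assms equiv_germ_rel by (simp add: mem_germ equiv_class_eq_iff)
  then show "\<exists>\<alpha>' g' \<beta>' \<xi>. \<xi> \<in> bpaths \<and> brng \<xi> = psrc \<beta>' \<and>
     ((\<alpha>', g', \<beta>'), bcat \<beta>' \<xi>) \<in> germ (\<alpha>, g, \<beta>) (bcat \<beta> \<zeta>) \<and> bcat \<alpha> (bact g \<zeta>) = bcat \<alpha>' (bact g' \<xi>)"
    using assms by blast
next
  fix \<eta>
  assume "\<exists>\<alpha>' g' \<beta>' \<xi>. \<xi> \<in> bpaths \<and> brng \<xi> = psrc \<beta>' \<and>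
     ((\<alpha>', g', \<beta>'), bcat \<beta>' \<xi>) \<in> germ (\<alpha>, g, \<beta>) (bcat \<beta> \<zeta>) \<and> \<eta> = bcat \<alpha>' (bact g' \<xi>)"
  then show "\<eta> = bcat \<alpha> (bact g \<zeta>)"
    unfolding mem_germ using range_well_defined assms(3) by metis
qed

lemma bcat_vertex [simp]: "brng \<xi> = v \<Longrightarrow> bcat (v, []) \<xi> = \<xi>"
  by (cases \<xi>) (auto simp: pcat_def plen_def)

lemma boundary_subset: "boundary \<subseteq> bpaths"
  by (auto simp: boundary_def bpaths_def)

abbreviation isotropy_triple :: "'g \<Rightarrow> ('g, 'e, 'g) triple" where
  "isotropy_triple k \<equiv> ((grng G k, []), k, (gsrc G k, []))"

text \<open>Supplies the germs that will witness failure of the Hausdorff property already in the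
  smallest groupoid. Because \<open>k\<close> fixes \<eta>, the range of the germ is again \<eta>
  and lies in the boundary.\<close>

lemma isotropy_germ_in_bG00:
  assumes k: "k \<in> arrows G" "grng G k = gsrc G k"
    and \<eta>: "\<eta> \<in> boundary" "brng \<eta> = gsrc G k" "bact k \<eta> = \<eta>"
  shows "(isotropy_triple k, \<eta>) \<in> germ_reps" "germ (isotropy_triple k) \<eta> \<in> arrows bG00"
proof -
  let ?v = "gsrc G k"
  let ?t = "isotropy_triple k"
  have \<eta>b: "\<eta> \<in> bpaths" using \<eta> boundary_subset by blast
  have v: "?v \<in> verts E" using k gsrc_vert by blast
  have c: "bcat (?v, []) \<eta> = \<eta>" using \<eta> by simp
  show r: "(?t, \<eta>) \<in> germ_reps"
    using k \<eta> \<eta>b v by (simp add: germ_reps_iff)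
  have src: "germ_source (germ ?t \<eta>) = \<eta>" using germ_source_germ r by blast
  have rng: "germ_range (germ ?t \<eta>) = \<eta>"
    using germ_range_germ[of "(grng G k, [])" k "(?v, [])" \<eta>] r c \<eta>b \<eta> k by simp
  have g: "germ ?t \<eta> \<in> germs" using r germ_in_germs by blast
  \<comment> \<open>The vertex serves as the path \<beta> in the definition of \<open>tG00\<close>:
    the loop \<open>k\<close> fixes it and restricts to itself there.\<close>
  have "\<exists>g \<beta> \<xi>. germ ?t \<eta> = germ (pact g \<beta>, pres g \<beta>, \<beta>) (bcat \<beta> \<xi>) \<and>
        g \<in> arrows G \<and> \<beta> \<in> fpaths \<and> gsrc G g = prng \<beta> \<and> \<xi> \<in> bpaths \<and> brng \<xi> = psrc \<beta>"
    by (intro exI[of _ k] exI[of _ "(?v, [])"] exI[of _ \<eta>])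
      (use k v \<eta> \<eta>b c in \<open>simp add: pact_def pres_def\<close>)
  then show "germ ?t \<eta> \<in> arrows bG00"
    using g src rng \<eta>(1)
    by (simp add: bG00_def bG_def tG00_def tG_def restrict_arrows_def reduction_def)
qed

lemma arrows_bG00_subset: "arrows bG00 \<subseteq> arrows tG00" "arrows bG00 \<subseteq> arrows bG"
  by (auto simp: bG00_def restrict_arrows_def)

text \<open>The action on paths preserves length.\<close>

lemma arrows_tG00_subset: "arrows tG00 \<subseteq> arrows tG0"
proof
  fix X assume "X \<in> arrows tG00"
  then obtain g \<beta> \<xi> where X: "X = germ (pact g \<beta>, pres g \<beta>, \<beta>) (bcat \<beta> \<xi>)" "X \<in> germs"
    "g \<in> arrows G" "\<beta> \<in> fpaths" "gsrc G g = prng \<beta>" "\<xi> \<in> bpaths" "brng \<xi> = psrc \<beta>"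
    by (auto simp: tG00_def tG_def restrict_arrows_def)
  obtain w b where \<beta>: "\<beta> = (w, b)" by (metis surj_pair)
  have "((pact g \<beta>, pres g \<beta>, \<beta>), bcat \<beta> \<xi>) \<in> germ_reps"
    using X(3-7) action_on_path[of g b] bcat_bpath[of w b \<xi>]
    by (simp add: \<beta> pact_def pres_def germ_reps_iff)
  moreover have "plen (pact g \<beta>) = plen \<beta>" by (simp add: plen_def pact_def)
  ultimately have "X \<in> {germ (\<alpha>, g, \<beta>) \<xi> |\<alpha> g \<beta> \<xi>. ((\<alpha>, g, \<beta>), \<xi>) \<in> germ_reps \<and> plen \<alpha> = plen \<beta>}"
    using X(1) by blast
  then show "X \<in> arrows tG0"
    using X(2) by (simp add: tG0_def tG_def restrict_arrows_def)
qed

text \<open>All topologies are induced from \<open>germ_topology\<close>, and subspaces of Hausdorff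
  spaces are Hausdorff.\<close>

lemma hausdorff_germs_mono:
  assumes "hausdorff_germs H" "arrows K \<subseteq> arrows H"
  shows "hausdorff_germs K"
proof -
  have "subtopology germ_topology (arrows K) = subtopology (subtopology germ_topology (arrows H)) (arrows K)"
    using assms(2) by (simp add: subtopology_subtopology Int_absorb1)
  then show ?thesis
    using assms(1) Hausdorff_space_subtopology unfolding hausdorff_germs_def by metis
qed

section \<open>Density of the boundary and cluster points of families of paths\<close>

text \<open>Continue from the source of \<open>l\<close>: if a singular vertex is reachable, stop
  there; otherwise every path can be prolonged by an edge, and dependent choice yields an infinite
  path. This allows the failure of separation to be realised over boundary paths.\<close>

lemma boundary_dense:
  assumes "is_path v l"
  shows "\<exists>\<eta>\<in>boundary. \<eta> \<in> cyl (v, l)"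
proof -
  have "\<exists>\<zeta>\<in>boundary. brng \<zeta> = w" if w: "w \<in> verts E" for w
  proof (cases "\<exists>m. is_path w m \<and> singular (psrc (w, m))")
    case True
    then obtain m where "is_path w m" "singular (psrc (w, m))" by blast
    then have "FinP (w, m) \<in> boundary" by (auto simp: boundary_def)
    then show ?thesis by force
  next
    case False
    have "\<exists>e. e \<in> arcs E \<and> head E e = psrc (w, m)" if "is_path w m" for m
      using False that by (auto simp: singular_def)
    then have "\<exists>f. \<forall>n. (is_path w (f n) \<and> length (f n) = n) \<and> (\<exists>e. f (Suc n) = f n @ [e])"
    proof (intro dependent_nat_choice)
      show "\<exists>m. is_path w m \<and> length m = 0" using w by (intro exI[of _ "[]"]) simp
    next
      fix m and n :: nat assume m: "is_path w m \<and> length m = n"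
      then obtain e where e: "e \<in> arcs E" "head E e = psrc (w, m)"
        using \<open>\<And>m. is_path w m \<Longrightarrow> \<exists>e. e \<in> arcs E \<and> head E e = psrc (w, m)\<close> by blast
      then have "is_path w (m @ [e])" using m by simp
      then show "\<exists>m'. (is_path w m' \<and> length m' = Suc n) \<and> (\<exists>e. m' = m @ [e])"
        using m by (intro exI[of _ "m @ [e]"]) auto
    qed
    then obtain f where f: "\<And>n. is_path w (f n)" "\<And>n. length (f n) = n" "\<And>n. \<exists>e. f (Suc n) = f n @ [e]"
      by blast
    then obtain x where x: "\<And>n. f (Suc n) = f n @ [x n]" by metis
    have arc: "x n \<in> arcs E \<and> head E (x n) = psrc (w, f n) \<and> tail E (x n) = psrc (w, f (Suc n))" for n
      using f(1)[of "Suc n"] unfolding x by simp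
    then have "x \<in> infpaths" by (simp add: infpaths_def)
    moreover have "head E (x 0) = w" using arc[of 0] f(2)[of 0] by simp
    ultimately show ?thesis by (auto simp: boundary_def intro!: bexI[of _ "InfP x"])
  qed
  then obtain \<zeta> where \<zeta>: "\<zeta> \<in> boundary" "brng \<zeta> = psrc (v, l)"
    using psrc_verts[OF assms] by blast
  \<comment> \<open>Prepending \<open>l\<close> keeps the source of a finite path, hence its
    singularity, and keeps infinite paths infinite.\<close>
  have "bcat (v, l) \<zeta> \<in> boundary"
  proof (cases \<zeta>)
    case (FinP \<mu>)
    then show ?thesis using \<zeta> assms by (cases \<mu>) (auto simp: boundary_def pcat_def)
  next
    case (InfP x)
    have "bcat (v, l) \<zeta> \<in> bpaths" using bcat_bpath[OF assms] \<zeta> boundary_subset by blast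
    then show ?thesis using InfP by (auto simp: boundary_def bpaths_def simp del: bcat.simps) (simp add: image_iff)
  qed
  moreover have "bcat (v, l) \<zeta> \<in> cyl (v, l)"
    using \<zeta> boundary_subset by (auto simp: cyl_def)
  ultimately show ?thesis by blast
qed

text \<open>An injective sequence takes each exceptional value at most once, so only finitely many
  indices are exceptional.\<close>

lemma eventually_inj_finite:
  fixes f :: "nat \<Rightarrow> 'c"
  assumes "inj f" "finite {x \<in> range f. \<not> P x}"
  shows "eventually (\<lambda>n. P (f n)) sequentially"
proof -
  have "f ` {n. \<not> P (f n)} \<subseteq> {x \<in> range f. \<not> P x}" by auto
  then have "finite {n. \<not> P (f n)}"
    using assms finite_imageD finite_subset inj_on_subset by (metis subset_UNIV)
  then show ?thesis by (simp add: eventually_cofinite flip: cofinite_eq_sequentially)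
qed

text \<open>
  Koenig's lemma: follow the prefixes shared by infinitely many members of \<open>M\<close>. Either this continues
  forever, or it stops at a path whose source receives infinitely many edges.
\<close>

lemma infinite_paths_cluster:
  assumes inf: "infinite M" and paths: "\<And>m. m \<in> M \<Longrightarrow> is_path v m"
  obtains \<xi> \<mu> where "\<xi> \<in> boundary" "brng \<xi> = v" "\<And>n::nat. \<mu> n \<in> M"
    "\<And>l. bprefix l \<xi> \<Longrightarrow> eventually (\<lambda>n. prefix l (\<mu> n)) sequentially"
    "\<And>l. \<not> bprefix l \<xi> \<Longrightarrow> eventually (\<lambda>n. \<not> prefix l (\<mu> n)) sequentially"
    "\<And>l. eventually (\<lambda>n. \<not> prefix (\<mu> n) l) sequentially"
proof -
  define fat where "fat l \<longleftrightarrow> infinite {m \<in> M. prefix l m}" for l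
  have fat_Nil: "fat []" using inf by (simp add: fat_def)
  have fat_ex: "\<exists>m\<in>M. prefix l m" if "fat l" for l
    using that not_finite_existsD unfolding fat_def by blast
  have fat_path: "is_path v l" if "fat l" for l
  proof -
    obtain m where m: "m \<in> M" "prefix l m" using fat_ex \<open>fat l\<close> by blast
    then obtain z where "m = l @ z" by (auto simp: prefix_def)
    with m show ?thesis using paths is_path_append by blast
  qed
  show ?thesis
  proof (cases "\<exists>a. fat a \<and> (\<forall>e. \<not> fat (a @ [e]))")
    case True
    \<comment> \<open>The finite path \<open>a\<close> will be the limit: each of its one-edge
      continuations is a prefix of only finitely many members.\<close>
    then obtain a where a: "fat a" "\<And>e. \<not> fat (a @ [e])" by blast
    define N where "N = {m \<in> M. prefix a m}"
    have N: "infinite N" using a(1) by (simp add: N_def fat_def)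
    have thin: "finite {m \<in> N. prefix (a @ [e]) m}" for e
      using a(2)[of e] unfolding fat_def N_def by (auto elim: rev_finite_subset)
    have extend: "\<exists>e. prefix (a @ [e]) m" if "prefix a m" "m \<noteq> a" for m
    proof -
      obtain z where z: "m = a @ z" using \<open>prefix a m\<close> by (auto simp: prefix_def)
      then obtain e z' where "z = e # z'" using \<open>m \<noteq> a\<close> by (cases z) auto
      then show ?thesis using z by auto
    qed
    \<comment> \<open>With finitely many edges available, the members extending \<open>a\<close>
      would be covered by finitely many finite sets together with \<open>a\<close> itself.\<close>
    have "infinite {e \<in> arcs E. head E e = psrc (v, a)}"
    proof
      assume fin: "finite {e \<in> arcs E. head E e = psrc (v, a)}"
      have "N \<subseteq> {a} \<union> (\<Union>e\<in>{e \<in> arcs E. head E e = psrc (v, a)}. {m \<in> N. prefix (a @ [e]) m})"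
      proof
        fix m assume m: "m \<in> N"
        show "m \<in> {a} \<union> (\<Union>e\<in>{e \<in> arcs E. head E e = psrc (v, a)}. {m \<in> N. prefix (a @ [e]) m})"
        proof (cases "m = a")
          case False
          then obtain e where e: "prefix (a @ [e]) m" using extend m N_def by blast
          then have "e \<in> arcs E \<and> head E e = psrc (v, a)"
            using paths[of m] m by (auto simp: N_def prefix_def)
          then show ?thesis using m e by blast
        qed simp
      qed
      then show False using N fin thin by (meson finite.emptyI finite.insertI finite_UN finite_Un finite_subset)
    qed
    then have bd: "FinP (v, a) \<in> boundary"
      using fat_path[OF a(1)] by (auto simp: boundary_def singular_def)
    obtain \<mu> :: "nat \<Rightarrow> 'e list" where \<mu>: "inj \<mu>" "range \<mu> \<subseteq> N"
      using infinite_countable_subset[OF N] by blast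
    have pre: "eventually (\<lambda>n. \<not> prefix (\<mu> n) l) sequentially" for l
    proof (rule eventually_inj_finite[OF \<mu>(1)])
      have "{x \<in> range \<mu>. \<not> \<not> prefix x l} \<subseteq> set (prefixes l)" by auto
      then show "finite {x \<in> range \<mu>. \<not> \<not> prefix x l}" by (rule finite_subset) simp
    qed
    \<comment> \<open>If \<open>l\<close> properly extends \<open>a\<close>, the members beginning
      with \<open>l\<close> pass through one thin continuation of \<open>a\<close>; if
      \<open>l\<close> and \<open>a\<close> are not comparable, no member of \<open>N\<close> begins
      with \<open>l\<close>.\<close>
    have not: "eventually (\<lambda>n. \<not> prefix l (\<mu> n)) sequentially" if l: "\<not> prefix l a" for l
    proof (rule eventually_inj_finite[OF \<mu>(1)])
      show "finite {x \<in> range \<mu>. \<not> \<not> prefix l x}"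
      proof (cases "prefix a l")
        case True
        then obtain e where e: "prefix (a @ [e]) l" using extend l by auto
        have "{x \<in> range \<mu>. \<not> \<not> prefix l x} \<subseteq> {m \<in> N. prefix (a @ [e]) m}"
          using \<mu>(2) e prefix_order.trans by blast
        then show ?thesis using thin finite_subset by blast
      next
        case False
        then have "{x \<in> range \<mu>. \<not> \<not> prefix l x} = {}"
          using l \<mu>(2) prefix_same_cases unfolding N_def by blast
        then show ?thesis by (metis finite.emptyI)
      qed
    qed
    show ?thesis
    proof (rule that[of "FinP (v, a)" \<mu>])
      show "eventually (\<lambda>n. prefix l (\<mu> n)) sequentially" if "bprefix l (FinP (v, a))" for l
        using that \<mu>(2) prefix_order.trans unfolding N_def by (intro always_eventually) auto
    qed (use bd \<mu> not pre in \<open>auto simp: N_def\<close>)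
  next
    case False
    \<comment> \<open>Every shared prefix can now be prolonged by one edge; dependent choice gives a
      coherent chain with one list of each length.\<close>
    then have "\<exists>f. \<forall>n. (fat (f n) \<and> length (f n) = n) \<and> (\<exists>e. f (Suc n) = f n @ [e])"
    proof (intro dependent_nat_choice)
      show "\<exists>m. fat m \<and> length m = 0" using fat_Nil by auto
    next
      fix m and n :: nat assume m: "fat m \<and> length m = n"
      then obtain e where "fat (m @ [e])" using False by blast
      then show "\<exists>m'. (fat m' \<and> length m' = Suc n) \<and> (\<exists>e. m' = m @ [e])"
        using m by (intro exI[of _ "m @ [e]"]) auto
    qed
    then obtain f where f: "\<And>n. fat (f n)" "\<And>n. length (f n) = n" "\<And>n. \<exists>e. f (Suc n) = f n @ [e]"
      by blast
    then obtain x where x: "\<And>n. f (Suc n) = f n @ [x n]" by metis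
    have fx: "f n = map x [0..<n]" for n
      using f(2)[of 0] by (induction n) (auto simp: x)
    \<comment> \<open>The member chosen through \<open>f n\<close> has length at least
      \<open>n\<close>, so it is eventually too long to be a prefix of any given list.\<close>
    obtain \<mu> where \<mu>: "\<And>n. \<mu> n \<in> M \<and> prefix (f n) (\<mu> n)"
      using fat_ex[OF f(1)] by metis
    have arc: "x n \<in> arcs E \<and> head E (x n) = psrc (v, f n) \<and> tail E (x n) = psrc (v, f (Suc n))" for n
      using fat_path[OF f(1)[of "Suc n"]] unfolding x by simp
    then have xp: "x \<in> infpaths" by (simp add: infpaths_def)
    have len: "n \<le> length (\<mu> n)" for n
      using \<mu>[of n] f(2)[of n] prefix_length_le by metis
    have f_mono: "prefix (f m) (f n)" if "m \<le> n" for m n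
      using that unfolding fx prefix_map_upt by blast
    show ?thesis
    proof (rule that[of "InfP x" \<mu>])
      show "brng (InfP x) = v" using arc[of 0] f(2)[of 0] by simp
      show "eventually (\<lambda>n. prefix l (\<mu> n)) sequentially" if l: "bprefix l (InfP x)" for l
      proof -
        obtain k where k: "l = f k" using l fx by auto
        show ?thesis
          using f_mono[of k] \<mu> prefix_order.trans unfolding k eventually_sequentially by blast
      qed
      show "eventually (\<lambda>n. \<not> prefix l (\<mu> n)) sequentially" if l: "\<not> bprefix l (InfP x)" for l
      proof -
        \<comment> \<open>Once \<open>n\<close> reaches the length of \<open>l\<close>, a common
          extension \<open>\<mu> n\<close> of \<open>l\<close> and \<open>f n\<close> would make
          \<open>l\<close> a prefix of \<open>f n\<close>, hence of the infinite path.\<close>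
        have "\<not> prefix l (\<mu> n)" if n: "length l \<le> n" for n
        proof
          assume "prefix l (\<mu> n)"
          then have "prefix l (f n)"
            using \<mu>[of n] f(2)[of n] n prefix_length_prefix by metis
          then show False using l unfolding fx prefix_map_upt by auto
        qed
        then show ?thesis unfolding eventually_sequentially by blast
      qed
      show "eventually (\<lambda>n. \<not> prefix (\<mu> n) l) sequentially" for l
        unfolding eventually_sequentially
        using len prefix_length_le by (metis Suc_n_not_le_n order_trans)
    qed (use xp \<mu> in \<open>auto simp: boundary_def\<close>)
  qed
qed

text \<open>Induction on the generation of \<open>W\<close> reduces the claim to basic sets. There
  \<open>pos\<close> puts the cylinders into the large cylinder, while \<open>neg\<close> and
  \<open>pre\<close> together make each excluded path incomparable with late \<open>\<mu> n\<close>,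
  so that the two cylinders are disjoint.\<close>

lemma cylinders_converge:
  assumes path: "\<And>n. is_path v (\<mu> n)"
    and pos: "\<And>l. bprefix l \<xi> \<Longrightarrow> eventually (\<lambda>n. prefix l (\<mu> n)) sequentially"
    and neg: "\<And>l. \<not> bprefix l \<xi> \<Longrightarrow> eventually (\<lambda>n. \<not> prefix l (\<mu> n)) sequentially"
    and pre: "\<And>l. eventually (\<lambda>n. \<not> prefix (\<mu> n) l) sequentially"
    and \<xi>: "brng \<xi> = v" "\<xi> \<in> bpaths"
    and W: "openin path_topology W" "\<xi> \<in> W"
  shows "eventually (\<lambda>n. cyl (v, \<mu> n) \<subseteq> W) sequentially"
  using W unfolding path_topology_def openin_topology_generated_by_iff
proof (induction rule: generate_topology_on.induct)
  case (Int A B)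
  then have "eventually (\<lambda>n. cyl (v, \<mu> n) \<subseteq> A) sequentially"
    "eventually (\<lambda>n. cyl (v, \<mu> n) \<subseteq> B) sequentially" by auto
  then show ?case by eventually_elim auto
next
  case (UN K)
  then obtain k where "k \<in> K" "eventually (\<lambda>n. cyl (v, \<mu> n) \<subseteq> k) sequentially" by auto
  then show ?case by (auto elim!: eventually_mono)
next
  case (Basis W)
  then obtain w a F where W: "W = cyl (w, a) - (\<Union>\<beta>\<in>F. cyl (pcat (w, a) \<beta>))" "(w, a) \<in> fpaths"
    "finite F" "F \<subseteq> {\<beta> \<in> fpaths. prng \<beta> = psrc (w, a)}"
    by auto
  have a: "is_path w a" using W by simp
  have w: "w = v" "bprefix a \<xi>" using Basis.prems W(1) mem_cyl_iff[OF a] \<xi> by auto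
  have F: "is_path v (a @ snd \<beta>)" if "\<beta> \<in> F" for \<beta>
    using that W(4) a w by (cases \<beta>) auto
  have "eventually (\<lambda>n. \<not> prefix (a @ snd \<beta>) (\<mu> n) \<and> \<not> prefix (\<mu> n) (a @ snd \<beta>)) sequentially"
    if "\<beta> \<in> F" for \<beta>
  proof -
    have "\<xi> \<notin> cyl (v, a @ snd \<beta>)" using Basis.prems W(1) that w by (auto simp: pcat_def)
    then have "\<not> bprefix (a @ snd \<beta>) \<xi>" using mem_cyl_iff[OF F[OF that]] \<xi> by blast
    then show ?thesis using neg pre eventually_conj by blast
  qed
  then have "eventually (\<lambda>n. \<forall>\<beta>\<in>F. \<not> prefix (a @ snd \<beta>) (\<mu> n) \<and> \<not> prefix (\<mu> n) (a @ snd \<beta>)) sequentially"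
    using W(3) by (simp add: eventually_ball_finite)
  with pos[OF w(2)] show ?case
  proof eventually_elim
    case (elim n)
    show ?case
    proof
      fix \<zeta> assume "\<zeta> \<in> cyl (v, \<mu> n)"
      then have \<zeta>: "\<zeta> \<in> bpaths" "brng \<zeta> = v" "bprefix (\<mu> n) \<zeta>"
        using mem_cyl_iff[OF path] by auto
      have "\<zeta> \<in> cyl (w, a)" using \<zeta> w elim(1) bprefix_prefix mem_cyl_iff[OF a] by blast
      moreover have "\<zeta> \<notin> cyl (pcat (w, a) \<beta>)" if "\<beta> \<in> F" for \<beta>
      proof
        assume "\<zeta> \<in> cyl (pcat (w, a) \<beta>)"
        then have "bprefix (a @ snd \<beta>) \<zeta>"
          using mem_cyl_iff[OF F[OF that]] w by (auto simp: pcat_def)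
        then show False
          using elim(2) that \<zeta>(3) bprefix_linear nat_le_linear by metis
      qed
      ultimately show "\<zeta> \<in> W" unfolding W(1) by blast
    qed
  qed
qed auto

section \<open>Non-separated germs\<close>

lemma ginv_vert: "v \<in> verts E \<Longrightarrow> ginv G v = v"
  using vert_unit[of v] gmult_gsrc[of "ginv G v"] by (metis ginv_closed gmult_ginv_left gsrc_ginv)

text \<open>The edge with index \<open>n\<close> of the image is determined by the prefix of length
  \<open>Suc n\<close>. This is applied to a limit path whose finite prefixes are all fixed.\<close>

lemma bact_fixed:
  assumes "\<And>l. bprefix l \<xi> \<Longrightarrow> act_list g l = l" "brng \<xi> = grng G g"
  shows "bact g \<xi> = \<xi>"
proof (cases \<xi>)
  case (FinP \<mu>)
  then show ?thesis using assms by (cases \<mu>) (auto simp: pact_def)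
next
  case (InfP x)
  have "act (res_list g (map x [0..<n])) (x n) = x n" for n
  proof -
    have "bprefix (map x [0..<Suc n]) \<xi>" unfolding InfP bprefix.simps by blast
    from assms(1)[OF this] show ?thesis
      by (auto simp: act_list_append)
  qed
  then show ?thesis using InfP by simp
qed

lemma bG00_Hausdorff_imp_cond_Fin:
  assumes haus: "hausdorff_germs bG00"
  shows cond_Fin
  unfolding cond_Fin_def
proof (rule ballI, rule ccontr)
  fix g assume g: "g \<in> arrows G" and inf: "infinite {\<mu>. minimal_strongly_fixed g \<mu>}"
  define v where "v = gsrc G g"
  define M where "M = {m. minimal_strongly_fixed g (v, m)}"
  \<comment> \<open>All these paths have range \<open>v\<close>, so they are determined by their
    edge lists.\<close>
  have "{\<mu>. minimal_strongly_fixed g \<mu>} \<subseteq> Pair v ` M"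
    by (auto simp: M_def v_def minimal_strongly_fixed_def strongly_fixed_iff)
  then have M: "infinite M" using inf finite_subset by blast
  have fixed: "strongly_fixed g (v, m)" if "m \<in> M" for m
    using that by (simp add: M_def minimal_strongly_fixed_def)
  then have path: "is_path v m" "grng G g = v" "act_list g m = m" if "m \<in> M" for m
    using that by (auto simp: strongly_fixed_iff)
  obtain \<xi> \<mu> where \<xi>: "\<xi> \<in> boundary" "brng \<xi> = v" and \<mu>: "\<And>n::nat. \<mu> n \<in> M"
    and pos: "\<And>l. bprefix l \<xi> \<Longrightarrow> eventually (\<lambda>n. prefix l (\<mu> n)) sequentially"
    and neg: "\<And>l. \<not> bprefix l \<xi> \<Longrightarrow> eventually (\<lambda>n. \<not> prefix l (\<mu> n)) sequentially"
    and pre: "\<And>l. eventually (\<lambda>n. \<not> prefix (\<mu> n) l) sequentially"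
    using infinite_paths_cluster[OF M path(1)] by blast
  have \<xi>b: "\<xi> \<in> bpaths" using \<xi> boundary_subset by blast
  have rg: "grng G g = v" using path(2) \<mu> by blast
  have v: "v \<in> verts E" using g gsrc_vert v_def by blast
  note vu = vert_unit[OF v]
  define t where "t = isotropy_triple g"
  define u where "u = isotropy_triple v"
  have t: "t = ((v, []), g, (v, []))" and u: "u = ((v, []), v, (v, []))"
    by (auto simp: t_def u_def rg v_def[symmetric] vu)
  \<comment> \<open>When \<open>g\<close> is compared with the unit \<open>v\<close>, the element
    h^-1 g is \<open>g\<close> itself.\<close>
  have kg: "gmult G (ginv G v) g = g" using ginv_vert v rg g gmult_grng by metis
  have eq_iff: "germ t \<zeta> = germ u \<zeta> \<longleftrightarrow> (\<exists>m. bprefix m \<zeta> \<and> strongly_fixed g (v, m))"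
    if "(t, \<zeta>) \<in> germ_reps" "(u, \<zeta>) \<in> germ_reps" for \<zeta>
    using same_ends_germ_eq_iff[of v "[]" g v "[]" \<zeta> v] that unfolding t u kg by simp
  have bact_v: "bact v \<zeta> = \<zeta>" if "\<zeta> \<in> bpaths" "brng \<zeta> = v" for \<zeta>
    using bact_fixed[of \<zeta> v] unit_action bpath_is_path that vu by metis
  have u_arrow: "(u, \<zeta>) \<in> germ_reps" "germ u \<zeta> \<in> arrows bG00" if "\<zeta> \<in> boundary" "brng \<zeta> = v" for \<zeta>
    using isotropy_germ_in_bG00[of v \<zeta>] vu that bact_v boundary_subset unfolding u_def by auto
  \<comment> \<open>A prefix of \<xi> is also a prefix of some fixed \<open>\<mu> n\<close>, and
    \<open>act_list\<close> preserves lengths, so the prefix is fixed, though perhaps not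
    strongly.\<close>
  have "act_list g l = l" if l: "bprefix l \<xi>" for l
  proof -
    obtain n where "prefix l (\<mu> n)"
      using pos[OF l] eventually_happens' sequentially_bot by blast
    then obtain z where z: "\<mu> n = l @ z" by (auto simp: prefix_def)
    then have "act_list g l @ act_list (res_list g l) z = l @ z"
      using path(3)[OF \<mu>[of n]] by (simp add: act_list_append)
    then show ?thesis by simp
  qed
  then have "bact g \<xi> = \<xi>" using bact_fixed \<xi> rg by simp
  then have t_arrow: "(t, \<xi>) \<in> germ_reps" "germ t \<xi> \<in> arrows bG00"
    using isotropy_germ_in_bG00[of g \<xi>] g rg v_def \<xi> unfolding t_def by auto
  have t_reps: "(t, \<zeta>) \<in> germ_reps" if "(u, \<zeta>) \<in> germ_reps" for \<zeta>
    using that g rg v_def unfolding t u germ_reps_iff by auto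
  \<comment> \<open>A strongly fixed prefix \<open>m\<close> of \<xi> would be a prefix of
    \<open>\<mu> n\<close> for all large \<open>n\<close>. Minimality then gives
    \<open>m = \<mu> n\<close>, whereas late \<open>\<mu> n\<close> are not prefixes of
    \<open>m\<close>.\<close>
  have "germ t \<xi> \<noteq> germ u \<xi>"
  proof
    assume "germ t \<xi> = germ u \<xi>"
    then obtain m where m: "bprefix m \<xi>" "strongly_fixed g (v, m)"
      using eq_iff t_arrow(1) u_arrow(1) \<xi> by blast
    have "eventually (\<lambda>n. prefix m (\<mu> n) \<and> \<not> prefix (\<mu> n) m) sequentially"
      using pos[OF m(1)] pre by (rule eventually_conj)
    then obtain n where "prefix m (\<mu> n)" "\<not> prefix (\<mu> n) m"
      using eventually_happens' sequentially_bot by blast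
    moreover from this have "m = \<mu> n"
      using minimal_strongly_fixed_unique m(2) \<mu> unfolding M_def by blast
    ultimately show False by simp
  qed
  moreover have cylv: "openin path_topology (cyl (v, []))" using v by (simp add: openin_cyl)
  have tr: "t \<in> triples" "u \<in> triples"
    using t_arrow u_arrow \<xi> by (auto simp: germ_reps_def t u)
  \<comment> \<open>The space of a generated topology is the union of its generators, so membership
    is shown by a basic open set around the germ.\<close>
  have top: "X \<in> topspace (subtopology germ_topology (arrows bG00))"
    if "X = germ s \<xi>" "s = t \<or> s = u" "X \<in> arrows bG00" for X s
  proof -
    have "\<xi> \<in> cyl (v, [])" using \<xi> \<xi>b v by (simp add: mem_cyl_iff)
    moreover have "openin germ_topology (germ s ` cyl (v, []))"
      using that(2) openin_germ_image tr cylv unfolding t u by blast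
    ultimately show ?thesis using that(1,3) openin_subset by fastforce
  qed
  ultimately obtain U V where UV: "openin germ_topology U" "openin germ_topology V"
    "germ t \<xi> \<in> U" "germ u \<xi> \<in> V" "disjnt (U \<inter> arrows bG00) (V \<inter> arrows bG00)"
    using haus top[of _ t] top[of _ u] t_arrow u_arrow \<xi>
    unfolding hausdorff_germs_def Hausdorff_space_def openin_subtopology
    by (metis (no_types, lifting) IntE)
  have pull: "openin path_topology {\<zeta> \<in> cyl (v, []). germ s \<zeta> \<in> A}"
    if s: "s = t \<or> s = u" and A: "openin germ_topology A" for s A
  proof -
    have "continuous_map (subtopology path_topology (cyl (v, []))) germ_topology (germ s)"
      using s continuous_map_germ tr unfolding t u by blast
    then have "openin (subtopology path_topology (cyl (v, []))) {\<zeta> \<in> topspace (subtopology path_topology (cyl (v, []))). germ s \<zeta> \<in> A}"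
      using A openin_continuous_map_preimage by blast
    moreover have "topspace (subtopology path_topology (cyl (v, []))) = cyl (v, [])"
      using cylv openin_subset by fastforce
    ultimately show ?thesis using openin_open_subtopology[OF cylv] by (simp only:)
  qed
  \<comment> \<open>The paths over which the two germs fall into their respective neighbourhoods,
    which are disjoint on \<open>arrows bG00\<close>.\<close>
  define W where "W = {\<zeta> \<in> cyl (v, []). germ t \<zeta> \<in> U} \<inter> {\<zeta> \<in> cyl (v, []). germ u \<zeta> \<in> V}"
  have "openin path_topology W" unfolding W_def using pull UV by (intro openin_Int) auto
  moreover have "\<xi> \<in> W" unfolding W_def using UV \<xi> \<xi>b v by (simp add: mem_cyl_iff)
  ultimately have "eventually (\<lambda>n. cyl (v, \<mu> n) \<subseteq> W) sequentially"
    using cylinders_converge[of v \<mu> \<xi> W] path(1)[OF \<mu>] pos neg pre \<xi>(2) \<xi>b by blast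
  then obtain n where n: "cyl (v, \<mu> n) \<subseteq> W"
    using eventually_happens' sequentially_bot by blast
  obtain \<eta> where \<eta>: "\<eta> \<in> boundary" "\<eta> \<in> cyl (v, \<mu> n)"
    using boundary_dense[OF path(1)[OF \<mu>]] by blast
  then have \<eta>v: "brng \<eta> = v" "bprefix (\<mu> n) \<eta>" using mem_cyl_iff[OF path(1)[OF \<mu>]] by auto
  \<comment> \<open>The strongly fixed prefix \<open>\<mu> n\<close> of \<eta> merges the two germs
    into one that lies in both neighbourhoods; being a unit over the boundary, it belongs to the
    smallest groupoid.\<close>
  then have "germ t \<eta> = germ u \<eta>"
    using eq_iff[of \<eta>] t_reps u_arrow(1) \<eta>(1) fixed \<mu> by blast
  moreover have "germ t \<eta> \<in> U" "germ u \<eta> \<in> V" using n \<eta>(2) W_def by auto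
  ultimately show False
    using UV(5) u_arrow(2)[OF \<eta>(1) \<eta>v(1)] by (auto simp: disjnt_def)
qed

text \<open>Closes a circle: (Fin) makes the largest groupoid Hausdorff, this passes to the subspace
  \<open>H\<close> and from \<open>H\<close> to the smallest groupoid, which gives (Fin)
  back.\<close>

lemma hausdorff_germs_iff_cond_Fin:
  assumes "arrows bG00 \<subseteq> arrows H" "arrows H \<subseteq> arrows tG"
  shows "hausdorff_germs H \<longleftrightarrow> cond_Fin"
  using assms hausdorff_germs_mono cond_Fin_imp_Hausdorff bG00_Hausdorff_imp_cond_Fin by blast

lemma arrows_between:
  assumes "H \<in> {tG, tG0, tG00, bG, bG0, bG00}"
  shows "arrows bG00 \<subseteq> arrows H" "arrows H \<subseteq> arrows tG"
proof -
  have "arrows bG00 \<subseteq> arrows tG0" using arrows_bG00_subset arrows_tG00_subset by blast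
  then have "arrows bG00 \<subseteq> arrows bG0"
    using arrows_bG00_subset by (auto simp: bG0_def restrict_arrows_def)
  moreover have "arrows tG0 \<subseteq> arrows tG" "arrows bG \<subseteq> arrows tG" "arrows bG0 \<subseteq> arrows tG0"
    by (auto simp: tG0_def bG_def bG0_def restrict_arrows_def reduction_def)
  ultimately show "arrows bG00 \<subseteq> arrows H" "arrows H \<subseteq> arrows tG"
    using assms arrows_bG00_subset arrows_tG00_subset by auto
qed

end

theorem proposition6p13:
  fixes E :: "('g, 'e) pre_digraph"
    and G :: "'g pre_groupoid"
    and act :: "'g \<Rightarrow> 'e \<Rightarrow> 'e"
    and res :: "'g \<Rightarrow> 'e \<Rightarrow> 'g"
  defines "groupoids \<equiv>
    {pre_self_similar.tG E G act res, pre_self_similar.tG0 E G act res,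
     pre_self_similar.tG00 E G act res, pre_self_similar.bG E G act res,
     pre_self_similar.bG0 E G act res, pre_self_similar.bG00 E G act res}"
  assumes "self_similar_action E G act res"
  shows "((\<exists>H\<in>groupoids. pre_self_similar.hausdorff_germs E G act res H) \<longrightarrow>
          (\<forall>H\<in>groupoids. pre_self_similar.hausdorff_germs E G act res H)) \<and>
         ((\<forall>H\<in>groupoids. pre_self_similar.hausdorff_germs E G act res H) \<longleftrightarrow>
          pre_self_similar.cond_Fin E G act res)"
proof -
  interpret self_similar_action E G act res by fact
  have "hausdorff_germs H \<longleftrightarrow> cond_Fin" if "H \<in> groupoids" for H
    using arrows_between[OF that[unfolded groupoids_def]] by (rule hausdorff_germs_iff_cond_Fin)
  moreover have "tG \<in> groupoids" unfolding groupoids_def by (rule insertI1)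
  ultimately show ?thesis by blast
qed

end
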